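(* 1. For any monomial $P$ in noncrossing partitions, there exists a unique polynomial $\Lambda(P)(X)\in\mathbb{K}[X]$ such that $\Lambda(P)(n)=|\mathrm{Lin}(P,n)|$ for all $n\ge1$. Moreover, the linear extension $\Lambda:\mathbb{K}[\mathcal{NCP}]\to\mathbb{K}[X]$ is a Hopf algebra morphism from $(\mathbb{K}[\mathcal{NCP}],m,\Delta)$ to $(\mathbb{K}[X],m,\Delta)$. 2. For any monomial $P$ in noncrossing partitions, there exists a unique polynomial $\Lambda^s(P)(X)\in\mathbb{K}[X]$ such that $\Lambda^s(P)(n)=|\mathrm{Lin}^s(P,n)|$ for all $n\ge1$. Moreover, the linear extension $\Lambda^s:\mathbb{K}[\mathcal{NCP}]\to\mathbb{K}[X]$ is a Hopf algebra morphism from $(\mathbb{K}[\mathcal{NCP}],m,\Delta)$ to $(\mathbb{K}[X],m,\Delta)$.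
   Context: $\mathbb{K}$ is a field of characteristic zero. A noncrossing partition is a partition $\pi$ of a set $[n]=\{1,\ldots,n\}$, $n\ge1$, into nonempty blocks such that there are no distinct blocks $b\ne b'$ and $x,z\in b$, $y,t\in b'$ with $x<y<z<t$. $\mathcal{NCP}$ is the set of all noncrossing partitions. For a nonempty set $Y$ of blocks of $\pi$, $\pi_{\mid Y}$ is the noncrossing partition obtained by deleting the blocks not in $Y$ and renumbering the remaining elements increasingly; $\pi_{\mid\emptyset}=1$. The nesting order on blocks is $b\le_\pi b'\iff b'\subseteq[\min b,\max b]$. An ideal of $\pi$ is a set $J$ of blocks that is upward closed for $\le_\pi$; then the union of its blocks decomposes into maximal subsets of consecutive integers $I_1,\ldots,I_k$, each a union of blocks, and $\pi_{\mid_\cdot J}=\prod_i\pi_{\mid I_i}$ (restriction to the blocks contained in $I_i$; product $\cdot$ below). $\mathbb{K}[\mathcal{NCP}]$ is the free commutative algebra generated by $\mathcal{NCP}$, with product $m=\cdot$ and unit the empty monomial $1$; a basis is given by the monomials in noncrossing partitions. Its coproduct $\Delta$ is the algebra morphism given on $\pi\in\mathcal{NCP}$ by $\Delta(\pi)=\sum_{J\text{ ideal of }\pi}\pi_{\mid\pi\setminus J}\otimes\pi_{\mid_\cdot J}$, with counit $\varepsilon_\Delta(\pi)=0$; $(\mathbb{K}[\mathcal{NCP}],m,\Delta)$ is a Hopf algebra. $\mathbb{K}[X]$ is a Hopf algebra with its usual product and the multiplicative coproduct $\Delta(X)=X\otimes1+1\otimes X$. For a monomial $P=\pi_1\cdot\ldots\cdot\pi_k$,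 its set of blocks is the disjoint union $\mathrm{Bl}(P)=\pi_1\sqcup\ldots\sqcup\pi_k$, partially ordered by $\le_P=\le_{\pi_1}\sqcup\ldots\sqcup\le_{\pi_k}$ (blocks of different factors are incomparable). For $n\ge1$, $\mathrm{Lin}(P,n)$ is the set of maps $f:\mathrm{Bl}(P)\to[n]$ such that $b\le_Pb'\Rightarrow f(b)\le f(b')$, and $\mathrm{Lin}^s(P,n)$ is the set of maps $f:\mathrm{Bl}(P)\to[n]$ such that ($b\le_Pb'$ and $b\ne b'$) $\Rightarrow f(b)<f(b')$. *)

theory Defs
  imports
    "HOL-Library.Disjoint_Sets"
    "HOL-Library.FuncSet"
    "HOL-Library.Multiset"
    "HOL-Library.Poly_Mapping"
    "HOL-Library.Product_Plus"
    "HOL-Computational_Algebra.Polynomial"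
begin

section \<open>Noncrossing partitions\<close>

definition is_ncp :: "nat set set \<Rightarrow> bool" where
  "is_ncp \<pi> \<longleftrightarrow>
     (\<exists>n\<ge>1. partition_on {1..n} \<pi>) \<and>
     \<not> (\<exists>b\<in>\<pi>. \<exists>b'\<in>\<pi>. b \<noteq> b' \<and>
          (\<exists>x y z t. x \<in> b \<and> z \<in> b \<and> y \<in> b' \<and> t \<in> b' \<and> x < y \<and> y < z \<and> z < t))"

typedef ncp = "{\<pi>. is_ncp \<pi>}"
  morphisms blocks Abs_ncp
proof
  have "partition_on {1..1::nat} {{1}}"
    by (simp add: partition_on_def)
  then show "{{1::nat}} \<in> {\<pi>. is_ncp \<pi>}"
    unfolding is_ncp_def by blast
qed

text \<open>Monomials in noncrossing partitions are finite multisets of noncrossing partitions, the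
  product of monomials being the sum of multisets and the empty monomial being \<open>{#}\<close>.\<close>

type_synonym ncp_monomial = "ncp multiset"

definition rank_in :: "nat set \<Rightarrow> nat \<Rightarrow> nat" where
  "rank_in U x = card {y \<in> U. y \<le> x}"

definition renumber :: "nat set set \<Rightarrow> nat set set" where
  "renumber Y = (\<lambda>b. rank_in (\<Union>Y) ` b) ` Y"

text \<open>This is only meant for \<open>Y \<subseteq> blocks \<pi>\<close>; lemma \<open>is_ncp_renumber\<close> below shows that
  \<^const>\<open>Abs_ncp\<close> is then applied to a noncrossing partition. The result is a monomial because of
  the convention that the restriction to the empty set of blocks is \<open>1\<close>.\<close>

definition restrict_ncp :: "nat set set \<Rightarrow> ncp_monomial" where
  "restrict_ncp Y = (if Y = {} then {#} else {# Abs_ncp (renumber Y) #})"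

lemma rank_in_strict_mono:
  assumes "finite U" "y \<in> U" "x < y"
  shows "rank_in U x < rank_in U y"
proof -
  have "{u \<in> U. u \<le> x} \<subseteq> {u \<in> U. u \<le> y}" using assms by auto
  moreover have "y \<in> {u \<in> U. u \<le> y}" "y \<notin> {u \<in> U. u \<le> x}" using assms by auto
  ultimately have "{u \<in> U. u \<le> x} \<subset> {u \<in> U. u \<le> y}" by blast
  then show ?thesis
    unfolding rank_in_def using assms(1) by (simp add: psubset_card_mono)
qed

lemma rank_in_less_iff:
  assumes "finite U" "x \<in> U" "y \<in> U"
  shows "rank_in U x < rank_in U y \<longleftrightarrow> x < y"
  by (metis assms linorder_neqE_nat not_less_iff_gr_or_eq rank_in_strict_mono)

lemma rank_in_inj_on: "finite U \<Longrightarrow> inj_on (rank_in U) U"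
  by (rule inj_onI) (metis linorder_neqE_nat nat_neq_iff rank_in_strict_mono)

lemma rank_in_image:
  assumes "finite U"
  shows "rank_in U ` U = {1..card U}"
proof (rule card_subset_eq)
  show "rank_in U ` U \<subseteq> {1..card U}"
  proof
    fix r assume "r \<in> rank_in U ` U"
    then obtain x where x: "x \<in> U" "r = rank_in U x" by blast
    have "{y \<in> U. y \<le> x} \<noteq> {}" using x by blast
    then have "1 \<le> r" using assms x unfolding rank_in_def
      by (simp add: Suc_le_eq card_gt_0_iff)
    moreover have "r \<le> card U"
      unfolding x rank_in_def using assms by (intro card_mono) auto
    ultimately show "r \<in> {1..card U}" by simp
  qed
  show "card (rank_in U ` U) = card {1..card U}"
    using rank_in_inj_on[OF assms] by (simp add: card_image)
qed simp

lemma is_ncp_renumber: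
  assumes "is_ncp \<pi>" "Y \<subseteq> \<pi>" "Y \<noteq> {}"
  shows "is_ncp (renumber Y)"
proof -
  let ?U = "\<Union>Y" and ?r = "rank_in (\<Union>Y)"
  obtain n where n: "partition_on {1..n} \<pi>" using assms(1) unfolding is_ncp_def by blast
  have nc: "\<And>b b' x y z t. b \<in> \<pi> \<Longrightarrow> b' \<in> \<pi> \<Longrightarrow> b \<noteq> b' \<Longrightarrow> x \<in> b \<Longrightarrow> z \<in> b \<Longrightarrow>
      y \<in> b' \<Longrightarrow> t \<in> b' \<Longrightarrow> x < y \<Longrightarrow> y < z \<Longrightarrow> z < t \<Longrightarrow> False"
    using assms(1) unfolding is_ncp_def by metis
  have fin: "finite ?U"
    using n assms(2) by (metis Sup_subset_mono finite_atLeastAtMost finite_subset partition_on_def)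
  have ne: "{} \<notin> Y" and disj: "disjoint Y"
    using n assms(2) unfolding partition_on_def disjoint_def by blast+
  have inj: "inj_on ?r ?U" using rank_in_inj_on[OF fin] .
  have "?U \<noteq> {}" using ne assms(3) by auto
  then have "card ?U \<ge> 1" using fin by (simp add: Suc_le_eq card_gt_0_iff)
  moreover have "partition_on {1..card ?U} (renumber Y)"
  proof (rule partition_onI)
    show "\<Union>(renumber Y) = {1..card ?U}"
      using rank_in_image[OF fin] unfolding renumber_def by (metis image_Union)
    show "{} \<notin> renumber Y"
      using ne unfolding renumber_def by auto
    show "disjnt p p'" if pp: "p \<in> renumber Y" "p' \<in> renumber Y" "p \<noteq> p'" for p p'
    proof -
      obtain b b' where b: "b \<in> Y" "b' \<in> Y" "p = ?r ` b" "p' = ?r ` b'"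
        using pp(1,2) unfolding renumber_def by blast
      have "b \<noteq> b'" using pp(3) b(3,4) by blast
      then have "b \<inter> b' = {}" using disj b(1,2) by (intro disjointD)
      moreover have "?r ` b \<inter> ?r ` b' = ?r ` (b \<inter> b')"
        using b(1,2) by (intro inj_on_image_Int[symmetric, OF inj]) blast+
      ultimately show ?thesis unfolding disjnt_def b(3,4) by simp
    qed
  qed
  moreover have "\<not> (\<exists>p\<in>renumber Y. \<exists>p'\<in>renumber Y. p \<noteq> p' \<and>
    (\<exists>x y z t. x \<in> p \<and> z \<in> p \<and> y \<in> p' \<and> t \<in> p' \<and> x < y \<and> y < z \<and> z < t))"
  proof (clarify)
    fix p p' x y z t
    assume h: "p \<in> renumber Y" "p' \<in> renumber Y" "p \<noteq> p'" "x \<in> p" "z \<in> p" "y \<in> p'" "t \<in> p'"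
      "x < y" "y < z" "z < t"
    obtain b b' where b: "b \<in> Y" "b' \<in> Y" "p = ?r ` b" "p' = ?r ` b'"
      using h(1,2) unfolding renumber_def by blast
    obtain x0 where x0: "x0 \<in> b" "x = ?r x0" using h(4) b(3) by blast
    obtain z0 where z0: "z0 \<in> b" "z = ?r z0" using h(5) b(3) by blast
    obtain y0 where y0: "y0 \<in> b'" "y = ?r y0" using h(6) b(4) by blast
    obtain t0 where t0: "t0 \<in> b'" "t = ?r t0" using h(7) b(4) by blast
    have U: "x0 \<in> ?U" "y0 \<in> ?U" "z0 \<in> ?U" "t0 \<in> ?U"
      using b(1,2) x0(1) y0(1) z0(1) t0(1) by blast+
    have lt: "x0 < y0" "y0 < z0" "z0 < t0"
      using h(8-10) U unfolding x0(2) y0(2) z0(2) t0(2)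
      by (simp_all add: rank_in_less_iff[OF fin] del: Union_iff)
    have "b \<noteq> b'" using h(3) b(3,4) by blast
    moreover have "b \<in> \<pi>" "b' \<in> \<pi>" using b(1,2) assms(2) by blast+
    ultimately show False
      using nc x0(1) y0(1) z0(1) t0(1) lt by metis
  qed
  ultimately show ?thesis unfolding is_ncp_def by (intro conjI exI[of _ "card ?U"])
qed

definition nest_le :: "nat set \<Rightarrow> nat set \<Rightarrow> bool" where
  "nest_le b b' \<longleftrightarrow> b' \<subseteq> {Min b..Max b}"

definition ideals :: "ncp \<Rightarrow> nat set set set" where
  "ideals \<pi> = {J. J \<subseteq> blocks \<pi> \<and> (\<forall>b\<in>J. \<forall>b'\<in>blocks \<pi>. nest_le b b' \<longrightarrow> b' \<in> J)}"

text \<open>The maximal nonempty sets of consecutive integers contained in \<open>U\<close>.\<close>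

definition runs :: "nat set \<Rightarrow> nat set set" where
  "runs U = {I. (\<exists>a b. a \<le> b \<and> I = {a..b}) \<and> I \<subseteq> U \<and>
                (\<forall>a b. I \<subseteq> {a..b} \<longrightarrow> {a..b} \<subseteq> U \<longrightarrow> {a..b} = I)}"

definition restrict_dot :: "ncp \<Rightarrow> nat set set \<Rightarrow> ncp_monomial" where
  "restrict_dot \<pi> J = (\<Sum>I\<in>runs (\<Union>J). restrict_ncp {b \<in> blocks \<pi>. b \<subseteq> I})"


section \<open>Order-preserving maps on the blocks of a monomial\<close>

text \<open>A block of a monomial is a triple: a factor \<open>\<pi>\<close>, an index telling apart the repeated
  occurrences of \<open>\<pi>\<close>, and a block of \<open>\<pi>\<close>.\<close>

definition Bl :: "ncp_monomial \<Rightarrow> (ncp \<times> nat \<times> nat set) set" where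
  "Bl P = {(\<pi>, i, b). i < count P \<pi> \<and> b \<in> blocks \<pi>}"

fun Bl_le :: "ncp \<times> nat \<times> nat set \<Rightarrow> ncp \<times> nat \<times> nat set \<Rightarrow> bool" where
  "Bl_le (\<pi>, i, b) (\<pi>', i', b') \<longleftrightarrow> \<pi> = \<pi>' \<and> i = i' \<and> nest_le b b'"

definition Lin :: "ncp_monomial \<Rightarrow> nat \<Rightarrow> (ncp \<times> nat \<times> nat set \<Rightarrow> nat) set" where
  "Lin P n = {f \<in> Bl P \<rightarrow>\<^sub>E {1..n}. \<forall>b\<in>Bl P. \<forall>b'\<in>Bl P. Bl_le b b' \<longrightarrow> f b \<le> f b'}"

definition Lin_s :: "ncp_monomial \<Rightarrow> nat \<Rightarrow> (ncp \<times> nat \<times> nat set \<Rightarrow> nat) set" where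
  "Lin_s P n = {f \<in> Bl P \<rightarrow>\<^sub>E {1..n}.
                  \<forall>b\<in>Bl P. \<forall>b'\<in>Bl P. Bl_le b b' \<and> b \<noteq> b' \<longrightarrow> f b < f b'}"

text \<open>The statement asserts that the polynomials selected by \<open>THE\<close> exist and are unique.\<close>

definition Lambda :: "ncp_monomial \<Rightarrow> 'k::field_char_0 poly" where
  "Lambda P = (THE p. \<forall>n\<ge>1. poly p (of_nat n) = of_nat (card (Lin P n)))"

definition Lambda_s :: "ncp_monomial \<Rightarrow> 'k::field_char_0 poly" where
  "Lambda_s P = (THE p. \<forall>n\<ge>1. poly p (of_nat n) = of_nat (card (Lin_s P n)))"


section \<open>The two Hopf algebras\<close>

text \<open>For a commutative monoid \<open>'a\<close>, the type \<open>'a \<Rightarrow>\<^sub>0 'k\<close> is the vector space with basis \<open>'a\<close>,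
  with the convolution product of the monoid algebra. Hence \<open>ncp_monomial \<Rightarrow>\<^sub>0 'k\<close> is the free
  commutative algebra on the noncrossing partitions. The tensor square of a space with basis \<open>'a\<close>
  is taken to be \<open>'a \<times> 'a \<Rightarrow>\<^sub>0 'k\<close>, the pair \<open>(a, a')\<close> standing for \<open>a \<otimes> a'\<close>; its product is the
  componentwise one. The basis of \<open>'k poly\<close> consists of the powers of \<open>X\<close>, so its tensor
  square is \<open>nat \<times> nat \<Rightarrow>\<^sub>0 'k\<close>.\<close>

definition pm_scale :: "'k \<Rightarrow> ('a \<Rightarrow>\<^sub>0 'k) \<Rightarrow> 'a \<Rightarrow>\<^sub>0 'k::field" where
  "pm_scale c = Poly_Mapping.map ((*) c)"

definition basis_elt :: "'a \<Rightarrow> 'a \<Rightarrow>\<^sub>0 'k::field" where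
  "basis_elt a = Poly_Mapping.single a 1"

definition lin_ext ::
    "('k \<Rightarrow> 'v \<Rightarrow> 'v) \<Rightarrow> ('a \<Rightarrow> 'v) \<Rightarrow> ('a \<Rightarrow>\<^sub>0 'k::field) \<Rightarrow> 'v::ab_group_add" where
  "lin_ext scl g x = (\<Sum>a\<in>Poly_Mapping.keys x. scl (Poly_Mapping.lookup x a) (g a))"

definition coprod_gen :: "ncp \<Rightarrow> ncp_monomial \<times> ncp_monomial \<Rightarrow>\<^sub>0 'k::field" where
  "coprod_gen \<pi> = (\<Sum>J\<in>ideals \<pi>. basis_elt (restrict_ncp (blocks \<pi> - J), restrict_dot \<pi> J))"

definition coprod_ncp ::
    "(ncp_monomial \<Rightarrow>\<^sub>0 'k::field) \<Rightarrow> ncp_monomial \<times> ncp_monomial \<Rightarrow>\<^sub>0 'k" where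
  "coprod_ncp = lin_ext pm_scale (\<lambda>P. \<Prod>\<pi>\<in>#P. coprod_gen \<pi>)"

text \<open>The algebra morphism vanishing on all noncrossing partitions.\<close>

definition counit_ncp :: "(ncp_monomial \<Rightarrow>\<^sub>0 'k::field) \<Rightarrow> 'k" where
  "counit_ncp = lin_ext (*) (\<lambda>P. \<Prod>\<pi>\<in>#P. 0)"

definition tensor_poly :: "'k poly \<Rightarrow> 'k poly \<Rightarrow> nat \<times> nat \<Rightarrow>\<^sub>0 'k::field" where
  "tensor_poly p q =
     (\<Sum>i\<le>Polynomial.degree p. \<Sum>j\<le>Polynomial.degree q.
        Poly_Mapping.single (i, j) (coeff p i * coeff q j))"

text \<open>The algebra morphism with \<open>X \<mapsto> X \<otimes> 1 + 1 \<otimes> X\<close>.\<close>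

definition coprod_poly :: "'k poly \<Rightarrow> nat \<times> nat \<Rightarrow>\<^sub>0 'k::field" where
  "coprod_poly p =
     (\<Sum>i\<le>Polynomial.degree p.
        pm_scale (coeff p i) ((tensor_poly [:0, 1:] 1 + tensor_poly 1 [:0, 1:]) ^ i))"

text \<open>The counit of \<open>coprod_poly\<close> is evaluation at \<open>0\<close>.\<close>

definition counit_poly :: "'k poly \<Rightarrow> 'k::field" where
  "counit_poly p = poly p 0"

text \<open>For an algebra \<open>'h\<close> with scalar multiplication \<open>scl\<close>, basis \<open>e\<close>, coproduct \<open>D\<close> and counit
  \<open>eps\<close>: \<open>S\<close> is linear with \<open>m \<circ> (S \<otimes> id) \<circ> D = \<eta> \<circ> eps = m \<circ> (id \<otimes> S) \<circ> D\<close>, where \<open>m\<close> is the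
  product and \<open>\<eta>\<close> the unit map.\<close>

definition is_antipode ::
    "('k::field \<Rightarrow> 'h::comm_ring_1 \<Rightarrow> 'h) \<Rightarrow> ('a \<Rightarrow> 'h) \<Rightarrow> ('h \<Rightarrow> 'a \<times> 'a \<Rightarrow>\<^sub>0 'k) \<Rightarrow>
     ('h \<Rightarrow> 'k) \<Rightarrow> ('h \<Rightarrow> 'h) \<Rightarrow> bool" where
  "is_antipode scl e D eps S \<longleftrightarrow>
     Vector_Spaces.linear scl scl S \<and>
     (\<forall>x. lin_ext scl (\<lambda>(a, a'). S (e a) * e a') (D x) = scl (eps x) 1) \<and>
     (\<forall>x. lin_ext scl (\<lambda>(a, a'). e a * S (e a')) (D x) = scl (eps x) 1)"

abbreviation is_antipode_ncp ::
    "((ncp_monomial \<Rightarrow>\<^sub>0 'k::field) \<Rightarrow> ncp_monomial \<Rightarrow>\<^sub>0 'k) \<Rightarrow> bool" where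
  "is_antipode_ncp \<equiv> is_antipode pm_scale basis_elt coprod_ncp counit_ncp"

abbreviation is_antipode_poly :: "('k::field poly \<Rightarrow> 'k poly) \<Rightarrow> bool" where
  "is_antipode_poly \<equiv> is_antipode smult (monom 1) coprod_poly counit_poly"

definition tensor_map ::
    "((ncp_monomial \<Rightarrow>\<^sub>0 'k::field) \<Rightarrow> 'k poly) \<Rightarrow>
     (ncp_monomial \<times> ncp_monomial \<Rightarrow>\<^sub>0 'k) \<Rightarrow> nat \<times> nat \<Rightarrow>\<^sub>0 'k" where
  "tensor_map F = lin_ext pm_scale (\<lambda>(P, Q). tensor_poly (F (basis_elt P)) (F (basis_elt Q)))"

definition hopf_morphism :: "((ncp_monomial \<Rightarrow>\<^sub>0 'k::field) \<Rightarrow> 'k poly) \<Rightarrow> bool" where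
  "hopf_morphism F \<longleftrightarrow>
     Vector_Spaces.linear pm_scale smult F \<and>
     F 1 = 1 \<and>
     (\<forall>x y. F (x * y) = F x * F y) \<and>
     (\<forall>x. coprod_poly (F x) = tensor_map F (coprod_ncp x)) \<and>
     (\<forall>x. counit_poly (F x) = counit_ncp x) \<and>
     (\<forall>S S'. is_antipode_ncp S \<longrightarrow> is_antipode_poly S' \<longrightarrow> F \<circ> S = S' \<circ> F)"

end

theory Submission
  imports Defs
begin

text \<open>
  Both parts are one statement for the comparison \<open>R\<close> on the naturals, where \<open>R\<close> is \<open>\<le>\<close> or \<open><\<close>.
  Everything rests on cutting a map \<open>f\<close> into \<open>{1..m+n}\<close> at level \<open>m\<close>: the elements with
  \<open>f > m\<close> form an upward closed set \<open>J\<close>, and \<open>f\<close> amounts to a map of the complement into \<open>{1..m}\<close>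
  and a map of \<open>J\<close> into \<open>{1..n}\<close>, with no condition between them (\<open>card_order_maps_add\<close>).

  For \<open>n = 1\<close> this says that the difference of consecutive counts is a combination of counts on
  smaller sets, whence by induction the count is an integer combination of binomial coefficients
  \<open>n choose k\<close>, and so a polynomial in \<open>n\<close> (\<open>card_order_maps_polynomial\<close>). The formula is valid
  at \<open>n = 0\<close>, where only the empty set has a map: this is compatibility with the counits.

  Counts are invariant under isomorphism and multiplicative on disjoint unions of incomparable
  parts. Renumbering blocks is an isomorphism for nesting, and by noncrossingness an ideal is the
  disjoint union of its parts in the runs of consecutive integers that it covers
  (\<open>map_count_restrict_dot\<close>). Hence for the blocks of a noncrossing partition the cutting identity
  reads \<open>\<Lambda>(\<pi>)(m + n) = \<Sum>\<^sub>J \<Lambda>(\<pi> restricted to \<pi> - J)(m) * \<Lambda>(\<pi> restricted to J)(n)\<close>. An element of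
  the tensor square of the polynomial algebra is determined by its values at pairs of naturals
  (\<open>eval2_eqD\<close>), so this is compatibility with the coproducts on generators, and it extends
  to all monomials by multiplicativity.

  For antipodes \<open>S\<close>, \<open>S'\<close> and the morphism \<open>F\<close> of bialgebras so obtained, \<open>F \<circ> S\<close> and \<open>S' \<circ> F\<close>
  are left inverses of \<open>F\<close> for convolution. Left inverses are unique as the coproduct of a monomial
  \<open>P\<close> is \<open>P \<otimes> 1\<close> plus terms with fewer blocks in the left factor
  (\<open>left_convolution_inverse_unique\<close>).
\<close>

section \<open>Linear extension\<close>

lemma vector_space_mult: "vector_space ((*) :: 'k::field \<Rightarrow> 'k \<Rightarrow> 'k)"
  by unfold_locales (auto simp: algebra_simps)

lemma vector_space_smult: "vector_space (smult :: 'k::field \<Rightarrow> 'k poly \<Rightarrow> 'k poly)"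
  by unfold_locales (auto simp: smult_add_right smult_add_left)

lemma lookup_pm_scale [simp]: "Poly_Mapping.lookup (pm_scale c x) a = c * Poly_Mapping.lookup x a"
  unfolding pm_scale_def by (simp add: Poly_Mapping.map.rep_eq when_def)

lemma vector_space_pm_scale: "vector_space (pm_scale :: 'k::field \<Rightarrow> ('a \<Rightarrow>\<^sub>0 'k) \<Rightarrow> _)"
  by unfold_locales (auto intro!: poly_mapping_eqI simp: lookup_add algebra_simps)

lemma pm_scale_eq_mult: "pm_scale c x = Poly_Mapping.single 0 c * (x :: 'a::monoid_add \<Rightarrow>\<^sub>0 'k::field)"
  unfolding pm_scale_def by (rule mult_map_scale_conv_mult)

lemma basis_elt_mult: "basis_elt a * basis_elt b = (basis_elt (a + b) :: 'a::monoid_add \<Rightarrow>\<^sub>0 'k::field)"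
  unfolding basis_elt_def by (simp add: mult_single)

lemma basis_elt_0: "basis_elt 0 = (1 :: 'a::monoid_add \<Rightarrow>\<^sub>0 'k::field)"
  unfolding basis_elt_def by simp

lemma linear_iff_additive_homogeneous:
  "Vector_Spaces.linear s1 s2 f \<longleftrightarrow> vector_space s1 \<and> vector_space s2 \<and>
     (\<forall>x y. f (x + y) = f x + f y) \<and> (\<forall>c x. f (s1 c x) = s2 c (f x))"
  unfolding Vector_Spaces.linear_def module_hom_def module_hom_axioms_def
    module_iff_vector_space by blast

lemma
  assumes "Vector_Spaces.linear s1 s2 f"
  shows linear_apply_add: "f (x + y) = f x + f y"
    and linear_apply_scale: "f (s1 c x) = s2 c (f x)"
  using assms unfolding linear_iff_additive_homogeneous by blast+

lemma lin_ext_superset: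
  assumes "vector_space scl" "finite A" "Poly_Mapping.keys x \<subseteq> A"
  shows "lin_ext scl g x = (\<Sum>a\<in>A. scl (Poly_Mapping.lookup x a) (g a))"
proof -
  interpret vector_space scl by fact
  show ?thesis
    unfolding lin_ext_def using assms(2,3)
    by (intro sum.mono_neutral_left) (auto simp: in_keys_iff)
qed

lemma linear_lin_ext:
  assumes "vector_space scl"
  shows "Vector_Spaces.linear pm_scale scl (lin_ext scl g)"
proof -
  interpret vector_space scl by fact
  have "lin_ext scl g (x + y) = lin_ext scl g x + lin_ext scl g y" for x y
  proof -
    let ?A = "Poly_Mapping.keys x \<union> Poly_Mapping.keys y"
    have "lin_ext scl g z = (\<Sum>a\<in>?A. scl (Poly_Mapping.lookup z a) (g a))"
      if "Poly_Mapping.keys z \<subseteq> ?A" for z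
      using that assms by (intro lin_ext_superset) auto
    then show ?thesis
      using keys_add[of x y] by (simp add: lookup_add scale_left_distrib sum.distrib)
  qed
  moreover have "lin_ext scl g (pm_scale c x) = scl c (lin_ext scl g x)" for c x
  proof -
    have "Poly_Mapping.keys (pm_scale c x) \<subseteq> Poly_Mapping.keys x"
      by (auto simp: in_keys_iff)
    then have "lin_ext scl g (pm_scale c x)
        = (\<Sum>a\<in>Poly_Mapping.keys x. scl (Poly_Mapping.lookup (pm_scale c x) a) (g a))"
      using assms by (intro lin_ext_superset) auto
    then show ?thesis by (simp add: lin_ext_def scale_sum_right)
  qed
  ultimately show ?thesis
    unfolding linear_iff_additive_homogeneous using assms vector_space_pm_scale by blast
qed

lemma lin_ext_basis_elt:
  assumes "vector_space scl"
  shows "lin_ext scl g (basis_elt a) = g a"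
proof -
  interpret vector_space scl by fact
  show ?thesis unfolding lin_ext_def basis_elt_def by simp
qed

lemma linear_sum_apply:
  assumes "Vector_Spaces.linear s1 s2 f"
  shows "f (sum h A) = (\<Sum>a\<in>A. f (h a))"
proof -
  interpret Vector_Spaces.linear s1 s2 f by fact
  show ?thesis by (rule sum)
qed

lemma linear_comp:
  assumes "Vector_Spaces.linear s1 s2 f" "Vector_Spaces.linear s2 s3 g"
  shows "Vector_Spaces.linear s1 s3 (\<lambda>x. g (f x))"
  using assms by (simp add: linear_iff_additive_homogeneous)

lemma linear_eq_lin_ext:
  assumes "Vector_Spaces.linear pm_scale scl f"
  shows "f x = lin_ext scl (\<lambda>a. f (basis_elt a)) x"
proof -
  have "x = (\<Sum>a\<in>Poly_Mapping.keys x. pm_scale (Poly_Mapping.lookup x a) (basis_elt a))"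
    by (rule poly_mapping_eqI)
       (auto simp: lookup_sum basis_elt_def lookup_single when_def in_keys_iff if_distrib
          cong: if_cong)
  then have "f x = (\<Sum>a\<in>Poly_Mapping.keys x. f (pm_scale (Poly_Mapping.lookup x a) (basis_elt a)))"
    using linear_sum_apply[OF assms] by metis
  then show ?thesis
    using assms unfolding lin_ext_def linear_iff_additive_homogeneous by simp
qed

lemma linear_eq_on_basis:
  assumes "Vector_Spaces.linear pm_scale scl f" "Vector_Spaces.linear pm_scale scl g"
    and "\<And>a. f (basis_elt a) = g (basis_elt a)"
  shows "f x = g x"
  using linear_eq_lin_ext[OF assms(1), of x] linear_eq_lin_ext[OF assms(2), of x] assms(3) by simp

lemma linear_apply_lin_ext:
  assumes "vector_space s1" "Vector_Spaces.linear s1 s2 h"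
  shows "h (lin_ext s1 g x) = lin_ext s2 (\<lambda>a. h (g a)) x"
proof -
  have "vector_space s2" using assms(2) by (simp add: linear_iff_additive_homogeneous)
  then show ?thesis
    using linear_eq_on_basis[OF linear_comp[OF linear_lin_ext[OF assms(1)] assms(2)]
        linear_lin_ext[of s2 "\<lambda>a. h (g a)"]] by (simp add: lin_ext_basis_elt assms(1))
qed

text \<open>Multiplicativity on basis elements suffices since both sides are bilinear, so
  \<open>linear_eq_on_basis\<close> applies in one argument and then in the other. It is used for
  \<open>\<Lambda>\<close> itself and for functionals on the two tensor squares.\<close>

lemma lin_ext_mult:
  fixes scl :: "'k::field \<Rightarrow> 'v::comm_ring_1 \<Rightarrow> 'v" and g :: "'a::comm_monoid_add \<Rightarrow> 'v"
  assumes vs: "vector_space scl" and alg: "\<And>c u v. scl c u * v = scl c (u * v)"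
    and g: "\<And>a b. g (a + b) = g a * g b"
  shows "lin_ext scl g (x * y) = lin_ext scl g x * lin_ext scl g y"
proof -
  interpret vector_space scl by fact
  let ?F = "lin_ext scl g"
  have F: "Vector_Spaces.linear pm_scale scl ?F" by (rule linear_lin_ext[OF vs])
  have lin_mult_right: "Vector_Spaces.linear pm_scale scl (\<lambda>x. ?F x * v)" for v
    using F by (simp add: linear_iff_additive_homogeneous distrib_right alg)
  have lin_mult_arg: "Vector_Spaces.linear pm_scale scl (\<lambda>x. ?F (x * z))" for z
    using F unfolding linear_iff_additive_homogeneous
    by (simp add: distrib_right pm_scale_eq_mult mult.assoc)
  show ?thesis
  proof (rule linear_eq_on_basis[OF lin_mult_arg lin_mult_right])
    fix a
    have "?F (y * basis_elt a) = ?F y * ?F (basis_elt a)"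
      by (rule linear_eq_on_basis[OF lin_mult_arg lin_mult_right])
         (simp add: basis_elt_mult lin_ext_basis_elt[OF vs] g)
    then show "?F (basis_elt a * y) = ?F (basis_elt a) * ?F y" by (simp add: mult.commute)
  qed
qed

lemma lin_ext_one:
  assumes "vector_space scl" "g 0 = 1"
  shows "lin_ext scl g (1 :: 'a::monoid_add \<Rightarrow>\<^sub>0 'k::field) = 1"
  using lin_ext_basis_elt[OF assms(1), of g 0] assms(2) by (simp add: basis_elt_0)

lemma lin_ext_prod_mset:
  fixes scl :: "'k::field \<Rightarrow> 'v::comm_ring_1 \<Rightarrow> 'v" and g :: "'a::comm_monoid_add \<Rightarrow> 'v"
  assumes "vector_space scl" "\<And>c u v. scl c u * v = scl c (u * v)"
    and "g 0 = 1" "\<And>a b. g (a + b) = g a * g b"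
  shows "lin_ext scl g (\<Prod>i\<in>#M. h i) = (\<Prod>i\<in>#M. lin_ext scl g (h i))"
  by (induction M) (simp_all add: lin_ext_one lin_ext_mult assms)

lemma linear_poly_eval: "Vector_Spaces.linear smult (*) (\<lambda>p. poly p (a :: 'k::field))"
  by (simp add: linear_iff_additive_homogeneous vector_space_mult vector_space_smult)

section \<open>Evaluation on the tensor square of the polynomial algebra\<close>

text \<open>The algebra morphism \<open>X \<otimes> 1 \<mapsto> x\<close>, \<open>1 \<otimes> X \<mapsto> y\<close>; it turns the coproduct into
  \<open>p \<mapsto> p(x + y)\<close>, so that compatibility with coproducts becomes an identity of numbers.\<close>

definition eval2 :: "'k::field \<Rightarrow> 'k \<Rightarrow> (nat \<times> nat \<Rightarrow>\<^sub>0 'k) \<Rightarrow> 'k" where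
  "eval2 x y = lin_ext (*) (\<lambda>(i, j). x ^ i * y ^ j)"

lemma linear_eval2: "Vector_Spaces.linear pm_scale (*) (eval2 x y)"
  unfolding eval2_def by (rule linear_lin_ext[OF vector_space_mult])

lemma eval2_mult: "eval2 x y (u * v) = eval2 x y u * eval2 x y v"
  unfolding eval2_def
  by (rule lin_ext_mult[OF vector_space_mult]) (auto simp: power_add)

lemma eval2_one: "eval2 x y 1 = 1"
  unfolding eval2_def by (rule lin_ext_one[OF vector_space_mult]) (simp add: zero_prod_def)

lemma eval2_power: "eval2 x y (u ^ n) = eval2 x y u ^ n"
  by (induction n) (simp_all add: eval2_one eval2_mult)

lemma eval2_single: "eval2 x y (Poly_Mapping.single (i, j) c) = c * (x ^ i * y ^ j)"
  unfolding eval2_def lin_ext_def by simp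

lemma eval2_tensor_poly: "eval2 x y (tensor_poly p q) = poly p x * poly q y"
proof -
  have "eval2 x y (tensor_poly p q) =
      (\<Sum>i\<le>Polynomial.degree p. \<Sum>j\<le>Polynomial.degree q. coeff p i * coeff q j * (x ^ i * y ^ j))"
    unfolding tensor_poly_def by (simp add: linear_sum_apply[OF linear_eval2] eval2_single)
  also have "\<dots> = poly p x * poly q y"
    unfolding poly_altdef sum_product by (intro sum.cong refl) (simp add: algebra_simps)
  finally show ?thesis .
qed

lemma eval2_coprod_poly: "eval2 x y (coprod_poly p) = poly p (x + y)"
proof -
  show ?thesis
    unfolding coprod_poly_def linear_sum_apply[OF linear_eval2] linear_apply_scale[OF linear_eval2]
      eval2_power linear_apply_add[OF linear_eval2] eval2_tensor_poly poly_altdef[of p] by simp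
qed

lemma poly_eq_if_eq_on_nats:
  fixes p q :: "'k::field_char_0 poly"
  assumes "\<And>n. n \<ge> 1 \<Longrightarrow> poly p (of_nat n) = poly q (of_nat n)"
  shows "p = q"
proof (rule ccontr)
  assume "p \<noteq> q"
  then have "finite {x. poly (p - q) x = 0}" by (intro poly_roots_finite) simp
  moreover have "of_nat ` {1..} \<subseteq> {x. poly (p - q) x = 0}" using assms by auto
  moreover have "infinite (of_nat ` {1::nat..} :: 'k set)"
    by (subst finite_image_iff) (auto simp: inj_on_def infinite_Ici)
  ultimately show False using finite_subset by blast
qed

text \<open>For fixed \<open>n\<close>, an element of the tensor square is a polynomial in the first variable, vanishing
  at all naturals, so its coefficients vanish; each of them is a polynomial in the second variable
  with the same property.\<close>

lemma eval2_eq_zeroD: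
  fixes z :: "nat \<times> nat \<Rightarrow>\<^sub>0 'k::field_char_0"
  assumes "\<And>m n. eval2 (of_nat m) (of_nat n) z = 0"
  shows "z = 0"
proof (rule poly_mapping_eqI)
  fix ij :: "nat \<times> nat"
  obtain i0 j0 where ij: "ij = (i0, j0)" by fastforce
  define N where "N = Suc (Max (insert 0 (fst ` Poly_Mapping.keys z \<union> snd ` Poly_Mapping.keys z)))"
  let ?A = "{..N} \<times> {..N}"
  let ?c = "\<lambda>i j. Poly_Mapping.lookup z (i, j)"
  have N: "i < N \<and> j < N" if "(i, j) \<in> Poly_Mapping.keys z" for i j
    unfolding N_def less_Suc_eq_le using that
    by (intro conjI Max_ge) (force intro: rev_image_eqI)+
  have "Poly_Mapping.keys z \<subseteq> ?A" using N by (auto intro: less_imp_le)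
  then have ev: "eval2 x y z = (\<Sum>i\<le>N. (\<Sum>j\<le>N. ?c i j * y ^ j) * x ^ i)" for x y
    unfolding eval2_def
    by (subst lin_ext_superset[OF vector_space_mult, of ?A])
       (auto simp: sum.cartesian_product' sum_distrib_left sum_distrib_right mult_ac)
  \<comment> \<open>The one-variable statement, to be used once for each variable.\<close>
  have coeff_0: "f k = 0" if "\<And>n. (\<Sum>i\<le>N. f i * of_nat n ^ i) = (0::'k)" "k \<le> N" for f k
  proof -
    have "(\<Sum>i\<le>N. monom (f i) i) = 0"
      using that(1) by (intro poly_eq_if_eq_on_nats) (simp add: poly_sum poly_monom)
    then have "coeff (\<Sum>i\<le>N. monom (f i) i) k = 0" by simp
    then show ?thesis using that(2) by (simp add: coeff_sum)
  qed
  have "?c i0 j0 = 0"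
  proof (cases "i0 \<le> N \<and> j0 \<le> N")
    case True
    have "(\<Sum>j\<le>N. ?c i0 j * of_nat n ^ j) = 0" for n
      using True assms ev by (intro coeff_0[of "\<lambda>i. \<Sum>j\<le>N. ?c i j * of_nat n ^ j"]) metis+
    then show ?thesis using True by (intro coeff_0[of "?c i0"]) auto
  next
    case False
    then show ?thesis using N[of i0 j0] by (metis in_keys_iff less_imp_le)
  qed
  then show "Poly_Mapping.lookup z ij = Poly_Mapping.lookup 0 ij" using ij by simp
qed

lemma eval2_eqD:
  fixes u v :: "nat \<times> nat \<Rightarrow>\<^sub>0 'k::field_char_0"
  assumes "\<And>m n. eval2 (of_nat m) (of_nat n) u = eval2 (of_nat m) (of_nat n) v"
  shows "u = v"
proof -
  have "eval2 x y (u - v + v) = eval2 x y (u - v) + eval2 x y v" for x y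
    by (rule linear_apply_add[OF linear_eval2])
  then have "u - v = 0" using assms by (intro eval2_eq_zeroD) (metis add_cancel_left_left diff_add_cancel)
  then show ?thesis by simp
qed

text \<open>The left-hand side is \<open>m \<circ> (S \<otimes> id)\<close> as it appears in the antipode axiom.\<close>

lemma lin_ext_tensor_poly:
  assumes S: "Vector_Spaces.linear smult smult S"
  shows "lin_ext smult (\<lambda>(i, j). S (monom 1 i) * monom 1 j) (tensor_poly p q) = S p * (q :: 'k::field poly)"
proof -
  let ?h = "\<lambda>(i, j). S (monom 1 i) * monom (1::'k) j"
  have lin: "Vector_Spaces.linear pm_scale smult (lin_ext smult ?h)"
    by (rule linear_lin_ext[OF vector_space_smult])
  have single: "lin_ext smult ?h (Poly_Mapping.single (i, j) c) = smult c (S (monom 1 i) * monom 1 j)" for i j c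
    by (simp add: lin_ext_def)
  have "S p = S (\<Sum>i\<le>Polynomial.degree p. smult (coeff p i) (monom 1 i))"
    by (subst poly_as_sum_of_monoms[of p, symmetric]) (simp add: smult_monom)
  then have Sp: "S p = (\<Sum>i\<le>Polynomial.degree p. smult (coeff p i) (S (monom 1 i)))"
    by (simp only: linear_sum_apply[OF S] linear_apply_scale[OF S])
  have q: "q = (\<Sum>j\<le>Polynomial.degree q. smult (coeff q j) (monom 1 j))"
    by (subst poly_as_sum_of_monoms[of q, symmetric]) (simp add: smult_monom)
  have "S p * q = (\<Sum>i\<le>Polynomial.degree p. \<Sum>j\<le>Polynomial.degree q.
      smult (coeff p i * coeff q j) (S (monom 1 i) * monom 1 j))"
    by (subst q, subst Sp) (simp add: sum_product mult.commute[of "coeff q _"])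
  then show ?thesis
    unfolding tensor_poly_def by (simp add: linear_sum_apply[OF lin] single)
qed

section \<open>Counting order-preserving maps\<close>

text \<open>With \<open>R\<close> equal to \<open>\<le>\<close> this gives the weakly, with \<open>R\<close> equal to \<open><\<close> the strictly
  order-preserving maps; excluding \<open>a = b\<close> makes one definition serve both, as \<open>\<le>\<close> is reflexive.\<close>

definition order_maps ::
    "(nat \<Rightarrow> nat \<Rightarrow> bool) \<Rightarrow> ('a \<Rightarrow> 'a \<Rightarrow> bool) \<Rightarrow> 'a set \<Rightarrow> nat \<Rightarrow> ('a \<Rightarrow> nat) set" where
  "order_maps R r A n =
     {f \<in> A \<rightarrow>\<^sub>E {1..n}. \<forall>a\<in>A. \<forall>b\<in>A. r a b \<and> a \<noteq> b \<longrightarrow> R (f a) (f b)}"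

definition up_sets :: "('a \<Rightarrow> 'a \<Rightarrow> bool) \<Rightarrow> 'a set \<Rightarrow> 'a set set" where
  "up_sets r A = {J. J \<subseteq> A \<and> (\<forall>a\<in>J. \<forall>b\<in>A. r a b \<longrightarrow> b \<in> J)}"

lemma finite_up_sets: "finite A \<Longrightarrow> finite (up_sets r A)"
  by (rule finite_subset[of _ "Pow A"]) (auto simp: up_sets_def)

lemma finite_order_maps: "finite A \<Longrightarrow> finite (order_maps R r A n)"
  by (rule finite_subset[of _ "A \<rightarrow>\<^sub>E {1..n}"]) (auto simp: order_maps_def intro: finite_PiE)

lemma mem_order_maps_iff:
  "f \<in> order_maps R r A n \<longleftrightarrow> f \<in> extensional A \<and> (\<forall>a\<in>A. 1 \<le> f a \<and> f a \<le> n) \<and>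
     (\<forall>a\<in>A. \<forall>b\<in>A. r a b \<and> a \<noteq> b \<longrightarrow> R (f a) (f b))"
  by (auto simp: order_maps_def PiE_iff)

lemma order_maps_empty [simp]: "order_maps R r {} n = {\<lambda>x. undefined}"
  by (auto simp: order_maps_def)

lemma order_maps_0: "A \<noteq> {} \<Longrightarrow> order_maps R r A 0 = {}"
  by (auto simp: order_maps_def)

lemma card_order_maps_iso:
  assumes bij: "bij_betw \<phi> A B" and r: "\<And>a b. a \<in> A \<Longrightarrow> b \<in> A \<Longrightarrow> s (\<phi> a) (\<phi> b) \<longleftrightarrow> r a b"
  shows "card (order_maps R s B n) = card (order_maps R r A n)"
proof (rule bij_betw_same_card, rule bij_betw_byWitness)
  let ?\<psi> = "inv_into A \<phi>"
  let ?pull = "\<lambda>f. restrict (\<lambda>a. f (\<phi> a)) A" and ?push = "\<lambda>g. restrict (\<lambda>b. g (?\<psi> b)) B"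
  have \<phi>: "\<phi> a \<in> B" "?\<psi> (\<phi> a) = a" if "a \<in> A" for a
    using that bij by (auto simp: bij_betw_def)
  have \<psi>: "?\<psi> b \<in> A" "\<phi> (?\<psi> b) = b" if "b \<in> B" for b
    using that bij by (auto simp: bij_betw_def inv_into_into f_inv_into_f)
  have inj: "\<phi> a = \<phi> b \<longleftrightarrow> a = b" if "a \<in> A" "b \<in> A" for a b
    using that \<phi>(2) by metis
  show "\<forall>f\<in>order_maps R s B n. ?push (?pull f) = f"
    by (auto simp: mem_order_maps_iff \<psi> intro!: extensionalityI[of _ B])
  show "\<forall>g\<in>order_maps R r A n. ?pull (?push g) = g"
    by (auto simp: mem_order_maps_iff \<phi> intro!: extensionalityI[of _ A])
  show "?pull ` order_maps R s B n \<subseteq> order_maps R r A n"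
    by (auto simp: mem_order_maps_iff \<phi> r inj)
  show "?push ` order_maps R r A n \<subseteq> order_maps R s B n"
  proof (rule image_subsetI)
    fix g assume g: "g \<in> order_maps R r A n"
    have "R (g (?\<psi> a)) (g (?\<psi> b))" if "a \<in> B" "b \<in> B" "s a b" "a \<noteq> b" for a b
    proof -
      have "r (?\<psi> a) (?\<psi> b)" "?\<psi> a \<noteq> ?\<psi> b" using that \<psi> r by metis+
      then show ?thesis using g that \<psi> by (auto simp: mem_order_maps_iff)
    qed
    then show "?push g \<in> order_maps R s B n"
      using g \<psi> by (auto simp: mem_order_maps_iff)
  qed
qed

lemma card_order_maps_Un:
  assumes disj: "A \<inter> B = {}"
    and incomparable: "\<And>a b. a \<in> A \<Longrightarrow> b \<in> B \<Longrightarrow> \<not> r a b \<and> \<not> r b a"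
  shows "card (order_maps R r (A \<union> B) n) = card (order_maps R r A n) * card (order_maps R r B n)"
proof -
  let ?glue = "\<lambda>(g, h). restrict (\<lambda>a. if a \<in> A then g a else h a) (A \<union> B)"
  have "bij_betw (\<lambda>f. (restrict f A, restrict f B))
      (order_maps R r (A \<union> B) n) (order_maps R r A n \<times> order_maps R r B n)"
  proof (rule bij_betw_byWitness[where f' = ?glue])
    show "\<forall>f\<in>order_maps R r (A \<union> B) n. ?glue (restrict f A, restrict f B) = f"
      by (auto simp: mem_order_maps_iff intro!: extensionalityI[of _ "A \<union> B"])
    show "\<forall>gh\<in>order_maps R r A n \<times> order_maps R r B n.
        (restrict (?glue gh) A, restrict (?glue gh) B) = gh"
    proof
      fix gh assume "gh \<in> order_maps R r A n \<times> order_maps R r B n"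
      then obtain g h where eq: "gh = (g, h)"
        and gh: "g \<in> order_maps R r A n" "h \<in> order_maps R r B n" by blast
      have "restrict (?glue (g, h)) A = g"
        using gh by (auto simp: mem_order_maps_iff intro!: extensionalityI[of _ A])
      moreover have "restrict (?glue (g, h)) B = h"
        using gh disj by (auto simp: mem_order_maps_iff intro!: extensionalityI[of _ B])
      ultimately show "(restrict (?glue gh) A, restrict (?glue gh) B) = gh"
        unfolding eq by blast
    qed
    show "(\<lambda>f. (restrict f A, restrict f B)) ` order_maps R r (A \<union> B) n
        \<subseteq> order_maps R r A n \<times> order_maps R r B n"
      by (auto simp: mem_order_maps_iff)
    show "?glue ` (order_maps R r A n \<times> order_maps R r B n) \<subseteq> order_maps R r (A \<union> B) n"
      using disj incomparable by (auto simp: mem_order_maps_iff)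
  qed
  then show ?thesis by (simp add: bij_betw_same_card card_cartesian_product)
qed

lemma card_order_maps_UN:
  assumes "finite I"
    and "\<And>i j. i \<in> I \<Longrightarrow> j \<in> I \<Longrightarrow> i \<noteq> j \<Longrightarrow> A i \<inter> A j = {}"
    and "\<And>i j a b. i \<in> I \<Longrightarrow> j \<in> I \<Longrightarrow> i \<noteq> j \<Longrightarrow> a \<in> A i \<Longrightarrow> b \<in> A j \<Longrightarrow> \<not> r a b"
  shows "card (order_maps R r (\<Union>i\<in>I. A i) n) = (\<Prod>i\<in>I. card (order_maps R r (A i) n))"
  using assms
proof (induction I rule: finite_induct)
  case (insert i I)
  have "card (order_maps R r (A i \<union> (\<Union>j\<in>I. A j)) n)
      = card (order_maps R r (A i) n) * card (order_maps R r (\<Union>j\<in>I. A j) n)"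
  proof (rule card_order_maps_Un)
    show "A i \<inter> (\<Union>j\<in>I. A j) = {}" using insert.hyps(2) insert.prems(1) by blast
    show "\<not> r a b \<and> \<not> r b a" if ab: "a \<in> A i" "b \<in> (\<Union>j\<in>I. A j)" for a b
    proof -
      obtain j where "j \<in> I" "b \<in> A j" using ab(2) by blast
      moreover have "i \<noteq> j" using calculation insert.hyps(2) by blast
      ultimately show ?thesis
        using ab(1) insert.prems(2)[of i j a b] insert.prems(2)[of j i b a] by blast
    qed
  qed
  also have "card (order_maps R r (\<Union>j\<in>I. A j) n) = (\<Prod>j\<in>I. card (order_maps R r (A j) n))"
    using insert.prems by (intro insert.IH) blast+
  finally show ?case using insert.hyps by simp
qed simp

text \<open>What \<open>\<le>\<close> and \<open><\<close> have in common for the purpose of cutting a map at a level \<open>m\<close>: the elements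
  above the level form an upward closed set by the first axiom, the pairs separated by the level
  are always in order by the second, and the values above the level may be lowered by \<open>m\<close> by the
  third.\<close>

locale comparison =
  fixes R :: "nat \<Rightarrow> nat \<Rightarrow> bool"
  assumes le_if_R: "R x y \<Longrightarrow> x \<le> y"
    and R_if_less: "x < y \<Longrightarrow> R x y"
    and R_shift: "R (x + m) (y + m) \<longleftrightarrow> R x y"
begin

text \<open>A map into \<open>{1..m+n}\<close> is the same as an upward closed set \<open>J\<close>, on which the values exceed \<open>m\<close>,
  together with a map of the complement into \<open>{1..m}\<close> and a map of \<open>J\<close> into \<open>{1..n}\<close>. This is
  the combinatorial source of the coproduct of noncrossing partitions, and also of the
  polynomiality below.\<close>

lemma card_order_maps_add:
  assumes fin: "finite A"
  shows "card (order_maps R r A (m + n)) =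
    (\<Sum>J\<in>up_sets r A. card (order_maps R r (A - J) m) * card (order_maps R r J n))"
proof -
  let ?cut = "\<lambda>f. {a \<in> A. m < f a}"
  let ?split = "\<lambda>f. (?cut f, restrict f (A - ?cut f), restrict (\<lambda>a. f a - m) (?cut f))"
  let ?glue = "\<lambda>(J, g, h). restrict (\<lambda>a. if a \<in> J then h a + m else g a) A"
  let ?T = "Sigma (up_sets r A) (\<lambda>J. order_maps R r (A - J) m \<times> order_maps R r J n)"
  have "bij_betw ?split (order_maps R r A (m + n)) ?T"
  proof (rule bij_betw_byWitness[where f' = ?glue])
    show "\<forall>f\<in>order_maps R r A (m + n). ?glue (?split f) = f"
      by (auto simp: mem_order_maps_iff intro!: extensionalityI[of _ A])
    show "\<forall>t\<in>?T. ?split (?glue t) = t"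
    proof
      fix t assume "t \<in> ?T"
      then obtain J g h where t: "t = (J, g, h)" and J: "J \<in> up_sets r A"
        and g: "g \<in> order_maps R r (A - J) m" and h: "h \<in> order_maps R r J n" by blast
      have JA: "J \<subseteq> A" using J by (auto simp: up_sets_def)
      have gm: "g a \<in> {1..m}" if "a \<in> A" "a \<notin> J" for a
        using g that by (auto simp: mem_order_maps_iff)
      have hn: "h a \<in> {1..n}" if "a \<in> J" for a
        using h that by (auto simp: mem_order_maps_iff)
      have cut: "?cut (?glue (J, g, h)) = J"
        using JA gm hn by (fastforce split: if_splits)
      have "restrict (?glue (J, g, h)) (A - J) = g"
        using g by (auto simp: mem_order_maps_iff intro!: extensionalityI[of _ "A - J"])
      moreover have "restrict (\<lambda>a. ?glue (J, g, h) a - m) J = h"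
        using h JA by (auto simp: mem_order_maps_iff intro!: extensionalityI[of _ J])
      ultimately show "?split (?glue t) = t" unfolding t cut by blast
    qed
    show "?split ` order_maps R r A (m + n) \<subseteq> ?T"
    proof (rule image_subsetI)
      fix f assume f: "f \<in> order_maps R r A (m + n)"
      have R: "R (f a) (f b)" if "a \<in> A" "b \<in> A" "r a b" "a \<noteq> b" for a b
        using f that by (auto simp: mem_order_maps_iff)
      have range: "f a \<in> {1..m + n}" if "a \<in> A" for a
        using f that by (auto simp: mem_order_maps_iff)
      have "R (f a - m) (f b - m)" if "a \<in> ?cut f" "b \<in> ?cut f" "r a b" "a \<noteq> b" for a b
        using R[of a b] R_shift[of "f a - m" m "f b - m"] that by auto
      then have "restrict (\<lambda>a. f a - m) (?cut f) \<in> order_maps R r (?cut f) n"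
        using range by (fastforce simp: mem_order_maps_iff)
      moreover have "restrict f (A - ?cut f) \<in> order_maps R r (A - ?cut f) m"
        using range R by (fastforce simp: mem_order_maps_iff)
      moreover have "?cut f \<in> up_sets r A"
        using R le_if_R by (fastforce simp: up_sets_def)
      ultimately show "?split f \<in> ?T" by blast
    qed
    show "?glue ` ?T \<subseteq> order_maps R r A (m + n)"
    proof (rule image_subsetI)
      fix t assume "t \<in> ?T"
      then obtain J g h where t: "t = (J, g, h)" and J: "J \<in> up_sets r A"
        and g: "g \<in> order_maps R r (A - J) m" and h: "h \<in> order_maps R r J n" by blast
      have gm: "g a \<in> {1..m}" if "a \<in> A" "a \<notin> J" for a
        using g that by (auto simp: mem_order_maps_iff)
      have hn: "h a \<in> {1..n}" if "a \<in> J" for a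
        using h that by (auto simp: mem_order_maps_iff)
      have "R (?glue (J, g, h) a) (?glue (J, g, h) b)"
        if ab: "a \<in> A" "b \<in> A" "r a b" "a \<noteq> b" for a b
      proof (cases "a \<in> J")
        case True
        moreover from this have "b \<in> J" using J ab by (auto simp: up_sets_def)
        ultimately show ?thesis using h ab by (auto simp: mem_order_maps_iff R_shift)
      next
        case a: False
        show ?thesis
        proof (cases "b \<in> J")
          case True
          then have "g a < h b + m" using gm[of a] hn[of b] a ab by auto
          then show ?thesis using a True ab by (simp add: R_if_less)
        next
          case False
          then show ?thesis using g a ab by (auto simp: mem_order_maps_iff)
        qed
      qed
      moreover have "1 \<le> ?glue (J, g, h) a \<and> ?glue (J, g, h) a \<le> m + n" if "a \<in> A" for a
        using gm[of a] hn[of a] that by auto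
      ultimately show "?glue t \<in> order_maps R r A (m + n)"
        unfolding t mem_order_maps_iff by auto
    qed
  qed
  then have "card (order_maps R r A (m + n)) = card ?T" by (rule bij_betw_same_card)
  also have "\<dots> = (\<Sum>J\<in>up_sets r A. card (order_maps R r (A - J) m \<times> order_maps R r J n))"
    using fin by (intro card_SigmaI finite_up_sets)
      (auto intro!: finite_cartesian_product finite_order_maps intro: finite_subset simp: up_sets_def)
  finally show ?thesis by (simp add: card_cartesian_product)
qed

text \<open>The cut at level \<open>n\<close> of maps into \<open>{1..n+1}\<close>, with the term \<open>J = {}\<close> moved to the left,
  expresses the difference of consecutive counts by counts on smaller sets; binomial coefficients
  are summed by raising their lower index. The formula includes \<open>n = 0\<close>, which gives the counit.
  The induction is on a bound \<open>N\<close> rather than on the cardinality, so that all smaller sets come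
  with expansions of the same length.\<close>

lemma card_order_maps_newton:
  assumes "finite A" "card A \<le> N"
  shows "\<exists>c. \<forall>n. card (order_maps R r A n) = (\<Sum>k\<le>N. c k * (n choose k))"
  using assms
proof (induction N arbitrary: A)
  case 0
  then show ?case by (intro exI[of _ "\<lambda>_. 1"]) simp
next
  case (Suc N)
  let ?\<J> = "up_sets r A - {{}}"
  have "\<exists>c. \<forall>n. card (order_maps R r (A - J) n) = (\<Sum>k\<le>N. c k * (n choose k))"
    if J: "J \<in> ?\<J>" for J
  proof (rule Suc.IH)
    have "A - J \<subset> A" using J by (auto simp: up_sets_def)
    then have "card (A - J) < card A" by (rule psubset_card_mono[OF Suc.prems(1)])
    then show "card (A - J) \<le> N" using Suc.prems(2) by simp
  qed (use Suc.prems in simp)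
  then obtain c where c: "\<And>J n. J \<in> ?\<J> \<Longrightarrow>
      card (order_maps R r (A - J) n) = (\<Sum>k\<le>N. c J k * (n choose k))" by metis
  define d where "d k = (\<Sum>J\<in>?\<J>. c J k * card (order_maps R r J 1))" for k
  have step: "card (order_maps R r A (Suc n)) =
      card (order_maps R r A n) + (\<Sum>k\<le>N. d k * (n choose k))" for n
  proof -
    have "{} \<in> up_sets r A" by (simp add: up_sets_def)
    then have "card (order_maps R r A (n + 1)) = card (order_maps R r A n) +
        (\<Sum>J\<in>?\<J>. card (order_maps R r (A - J) n) * card (order_maps R r J 1))"
      unfolding card_order_maps_add[OF Suc.prems(1)]
      by (subst sum.remove[of _ "{}"]) (use finite_up_sets[OF Suc.prems(1)] in simp_all)
    also have "(\<Sum>J\<in>?\<J>. card (order_maps R r (A - J) n) * card (order_maps R r J 1))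
        = (\<Sum>J\<in>?\<J>. \<Sum>k\<le>N. c J k * card (order_maps R r J 1) * (n choose k))"
      by (intro sum.cong refl) (simp add: c sum_distrib_left mult_ac)
    also have "\<dots> = (\<Sum>k\<le>N. d k * (n choose k))"
      by (subst sum.swap) (simp add: d_def sum_distrib_right)
    finally show ?thesis by simp
  qed
  \<comment> \<open>Newton coefficients of the sum of a sequence with Newton coefficients \<open>d\<close>.\<close>
  define e where "e k = (case k of 0 \<Rightarrow> card (order_maps R r A 0) | Suc j \<Rightarrow> d j)" for k
  have "card (order_maps R r A n) = (\<Sum>k\<le>Suc N. e k * (n choose k))" for n
  proof -
    have "card (order_maps R r A n) = card (order_maps R r A 0) + (\<Sum>k\<le>N. d k * (n choose Suc k))"
      by (induction n) (simp_all add: step sum.distrib[symmetric] algebra_simps)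
    then show ?thesis by (subst sum.atMost_Suc_shift) (simp add: e_def)
  qed
  then show ?case by blast
qed

lemma card_order_maps_polynomial:
  assumes "finite A"
  shows "\<exists>p :: 'k::field_char_0 poly. \<forall>n. poly p (of_nat n) = of_nat (card (order_maps R r A n))"
proof -
  obtain c where c: "\<And>n. card (order_maps R r A n) = (\<Sum>k\<le>card A. c k * (n choose k))"
    using card_order_maps_newton[OF assms order_refl] by blast
  define B :: "nat \<Rightarrow> 'k poly" where
    "B k = smult (inverse (fact k)) (\<Prod>i=0..<k. [:- of_nat i, 1:])" for k
  have B: "poly (B k) (of_nat n) = of_nat (n choose k)" for k n
    unfolding B_def by (simp add: binomial_gbinomial gbinomial_prod_rev poly_prod field_simps)
  have "poly (\<Sum>k\<le>card A. smult (of_nat (c k)) (B k)) (of_nat n)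
      = of_nat (card (order_maps R r A n))" for n
    by (simp add: poly_sum B c)
  then show ?thesis by blast
qed

end

section \<open>Blocks of noncrossing partitions\<close>

lemma is_ncp_blocks: "is_ncp (blocks \<pi>)"
  using blocks by simp

lemma blocks_partition: "\<exists>n\<ge>1. partition_on {1..n} (blocks \<pi>)"
  using is_ncp_blocks unfolding is_ncp_def by blast

lemma finite_Union_blocks: "finite (\<Union>(blocks \<pi>))"
  using blocks_partition[of \<pi>] by (auto simp: partition_on_def)

lemma finite_blocks [simp]: "finite (blocks \<pi>)"
  using finite_Union_blocks by (simp add: finite_UnionD)

lemma finite_block: "b \<in> blocks \<pi> \<Longrightarrow> finite b"
  using finite_Union_blocks by (meson Union_upper finite_subset)

lemma block_nonempty: "b \<in> blocks \<pi> \<Longrightarrow> b \<noteq> {}"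
  using blocks_partition[of \<pi>] by (auto simp: partition_on_def)

lemma blocks_nonempty: "blocks \<pi> \<noteq> {}"
  using blocks_partition[of \<pi>] by (auto simp: partition_on_def)

lemma blocks_disjoint: "b \<in> blocks \<pi> \<Longrightarrow> b' \<in> blocks \<pi> \<Longrightarrow> x \<in> b \<Longrightarrow> x \<in> b' \<Longrightarrow> b = b'"
  using blocks_partition[of \<pi>] by (meson disjointD disjoint_iff partition_onD2)

lemma blocks_noncrossing:
  assumes "b \<in> blocks \<pi>" "b' \<in> blocks \<pi>" "x \<in> b" "z \<in> b" "y \<in> b'" "t \<in> b'" "x < y" "y < z" "z < t"
  shows "b = b'"
  using is_ncp_blocks[of \<pi>] assms unfolding is_ncp_def by metis

lemma nest_le_iff_Min_Max:
  assumes "finite b'" "b' \<noteq> {}"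
  shows "nest_le b b' \<longleftrightarrow> Min b \<le> Min b' \<and> Max b' \<le> Max b"
  using assms unfolding nest_le_def by (auto simp: subset_iff)

lemma rank_in_mono: "finite U \<Longrightarrow> mono (rank_in U)"
  unfolding rank_in_def by (intro monoI card_mono) auto

text \<open>Nesting only compares minima and maxima, and ranks preserve and reflect the order on \<open>U\<close>; hence
  renumbering is an isomorphism for the nesting order.\<close>

lemma nest_le_rank_in_iff:
  assumes U: "finite U" "b \<subseteq> U" "b' \<subseteq> U" and ne: "b \<noteq> {}" "b' \<noteq> {}"
  shows "nest_le (rank_in U ` b) (rank_in U ` b') \<longleftrightarrow> nest_le b b'"
proof -
  have fin: "finite b" "finite b'" using U by (auto intro: finite_subset)
  have in_U: "Min b \<in> U" "Max b \<in> U" "Min b' \<in> U" "Max b' \<in> U"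
    using U ne fin Min_in Max_in by blast+
  have le_iff: "rank_in U x \<le> rank_in U y \<longleftrightarrow> x \<le> y" if "x \<in> U" "y \<in> U" for x y
    using rank_in_less_iff[OF U(1) that(2,1)] by (simp add: not_less[symmetric])
  note mono = rank_in_mono[OF U(1)]
  have "nest_le (rank_in U ` b) (rank_in U ` b') \<longleftrightarrow>
      Min (rank_in U ` b) \<le> Min (rank_in U ` b') \<and> Max (rank_in U ` b') \<le> Max (rank_in U ` b)"
    using fin(2) ne(2) by (intro nest_le_iff_Min_Max) simp_all
  also have "\<dots> \<longleftrightarrow> rank_in U (Min b) \<le> rank_in U (Min b') \<and> rank_in U (Max b') \<le> rank_in U (Max b)"
    by (simp only: mono_Min_commute[OF mono fin(1) ne(1)] mono_Min_commute[OF mono fin(2) ne(2)]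
        mono_Max_commute[OF mono fin(1) ne(1)] mono_Max_commute[OF mono fin(2) ne(2)])
  also have "\<dots> \<longleftrightarrow> nest_le b b'"
    by (simp only: le_iff in_U nest_le_iff_Min_Max[OF fin(2) ne(2)])
  finally show ?thesis .
qed

lemma blocks_Abs_renumber:
  assumes "Y \<subseteq> blocks \<pi>" "Y \<noteq> {}"
  shows "blocks (Abs_ncp (renumber Y)) = renumber Y"
  using is_ncp_renumber[OF is_ncp_blocks assms] by (simp add: Abs_ncp_inverse)

lemma bij_betw_renumber:
  assumes "Y \<subseteq> blocks \<pi>"
  shows "bij_betw ((`) (rank_in (\<Union>Y))) Y (renumber Y)"
proof -
  have "finite (\<Union>Y)" using assms finite_Union_blocks by (meson Union_mono finite_subset)
  then have "inj_on (rank_in (\<Union>Y)) (\<Union>Y)" by (rule rank_in_inj_on)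
  then have "inj_on ((`) (rank_in (\<Union>Y))) Y"
    by (intro inj_onI) (metis Union_upper inj_on_image_eq_iff)
  then show ?thesis unfolding renumber_def bij_betw_def by simp
qed

lemma restrict_ncp_blocks: "restrict_ncp (blocks \<pi>) = {#\<pi>#}"
proof -
  obtain n where n: "partition_on {1..n} (blocks \<pi>)" using blocks_partition by blast
  have "rank_in {1..n} x = x" if "x \<in> {1..n}" for x
  proof -
    have "{y \<in> {1..n}. y \<le> x} = {1..x}" using that by auto
    then show ?thesis unfolding rank_in_def by simp
  qed
  moreover have U: "\<Union>(blocks \<pi>) = {1..n}" using n by (simp add: partition_on_def)
  ultimately have "rank_in {1..n} ` b = b" if "b \<in> blocks \<pi>" for b
    using that by (metis Union_upper image_cong image_ident subsetD)
  then have "renumber (blocks \<pi>) = blocks \<pi>"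
    unfolding renumber_def U by simp
  then show ?thesis by (simp add: restrict_ncp_def blocks_nonempty blocks_inverse)
qed

definition block_count :: "ncp_monomial \<Rightarrow> nat" where
  "block_count P = (\<Sum>\<pi>\<in>#P. card (blocks \<pi>))"

lemma block_count_restrict_ncp:
  assumes "Y \<subseteq> blocks \<pi>"
  shows "block_count (restrict_ncp Y) = card Y"
  using bij_betw_same_card[OF bij_betw_renumber[OF assms]] blocks_Abs_renumber[OF assms]
  by (cases "Y = {}") (simp_all add: block_count_def restrict_ncp_def)

lemma run_maximal: "I \<in> runs U \<Longrightarrow> I \<subseteq> {a..b} \<Longrightarrow> {a..b} \<subseteq> U \<Longrightarrow> {a..b} = I"
  unfolding runs_def by simp

lemma run_disjoint:
  assumes "I \<in> runs U" "I' \<in> runs U" "x \<in> I" "x \<in> I'"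
  shows "I = I'"
proof -
  obtain a b c d where I: "I = {a..b}" "I' = {c..d}" using assms unfolding runs_def by blast
  have "{min a c..max b d} = I \<union> I'" using assms(3,4) unfolding I by auto
  moreover have "I \<union> I' \<subseteq> U" using assms(1,2) unfolding runs_def by blast
  ultimately have "{min a c..max b d} = I" "{min a c..max b d} = I'"
    by (intro run_maximal[OF assms(1)] run_maximal[OF assms(2)]; simp)+
  then show ?thesis by simp
qed

lemma interval_subset_run:
  assumes "finite U" "a \<le> b" "{a..b} \<subseteq> U"
  shows "\<exists>I\<in>runs U. {a..b} \<subseteq> I"
proof -
  let ?S = "{I. (\<exists>a b. a \<le> b \<and> I = {a..b}) \<and> I \<subseteq> U}"
  have fin: "finite ?S" by (rule finite_subset[of _ "Pow U"]) (use assms(1) in auto)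
  have ab: "{a..b} \<in> ?S" using assms(2,3) by blast
  obtain I where I: "I \<in> ?S" "{a..b} \<subseteq> I" and max: "\<forall>K\<in>?S. I \<subseteq> K \<longrightarrow> I = K"
    using finite_has_maximal2[OF fin ab] by blast
  have "{c..d} = I" if "I \<subseteq> {c..d}" "{c..d} \<subseteq> U" for c d
  proof -
    have "c \<le> d" using that(1) I(2) assms(2) by force
    then have "{c..d} \<in> ?S" using that(2) by blast
    then show ?thesis using max that(1) by blast
  qed
  then have "I \<in> runs U" using I(1) unfolding runs_def by simp
  then show ?thesis using I(2) by blast
qed

lemma finite_runs: "finite U \<Longrightarrow> finite (runs U)"
  by (rule finite_subset[of _ "Pow U"]) (auto simp: runs_def)

lemma restrict_dot_empty: "restrict_dot \<pi> {} = {#}"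
proof -
  have "runs {} = {}" by (auto simp: runs_def)
  then show ?thesis by (simp add: restrict_dot_def)
qed

lemma ideals_eq_up_sets: "ideals \<pi> = up_sets nest_le (blocks \<pi>)"
  by (simp add: ideals_def up_sets_def)

text \<open>If \<open>b'\<close> has an element strictly between two elements of \<open>b\<close> and another one outside
  \<open>[min b, max b]\<close>, then \<open>b\<close> and \<open>b'\<close> cross.\<close>

lemma nest_le_if_between:
  assumes bb': "b \<in> blocks \<pi>" "b' \<in> blocks \<pi>" and x: "x \<in> b'" "Min b \<le> x" "x \<le> Max b"
  shows "nest_le b b'"
proof (cases "b = b'")
  case True
  then show ?thesis using finite_block[OF bb'(1)] by (auto simp: nest_le_def)
next
  case False
  have ends: "Min b \<in> b" "Max b \<in> b" using finite_block block_nonempty bb'(1) by auto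
  have "Min b < x" "x < Max b"
    using x ends False blocks_disjoint[OF bb'] by (metis le_neq_implies_less)+
  then have "Min b \<le> y \<and> y \<le> Max b" if "y \<in> b'" for y
    using blocks_noncrossing[OF bb' ends x(1) that] blocks_noncrossing[OF bb'(2,1) that x(1) ends] False
    by force
  then show ?thesis by (auto simp: nest_le_def)
qed

text \<open>Every integer in \<open>[min b, max b]\<close> lies in a block nested in \<open>b\<close>, hence in the ideal. So this
  interval is covered by \<open>J\<close>, and a run contains it.\<close>

lemma block_of_ideal_subset_run:
  assumes J: "J \<in> ideals \<pi>" and b: "b \<in> J"
  shows "\<exists>I\<in>runs (\<Union>J). b \<subseteq> I"
proof -
  have JB: "J \<subseteq> blocks \<pi>" using J by (auto simp: ideals_def)
  have b': "b \<in> blocks \<pi>" using JB b by blast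
  note fin = finite_block[OF b'] and ne = block_nonempty[OF b']
  obtain n where n: "\<Union>(blocks \<pi>) = {1..n}" using blocks_partition[of \<pi>] by (auto simp: partition_on_def)
  have "{Min b..Max b} \<subseteq> \<Union>J"
  proof
    fix x assume x: "x \<in> {Min b..Max b}"
    have "{Min b, Max b} \<subseteq> {1..n}" using fin ne b' n Min_in Max_in by blast
    then have "x \<in> \<Union>(blocks \<pi>)" using x n by auto
    then obtain b'' where "b'' \<in> blocks \<pi>" "x \<in> b''" by blast
    moreover from this have "nest_le b b''" using x nest_le_if_between[OF b'] by auto
    ultimately show "x \<in> \<Union>J" using J b by (auto simp: ideals_def)
  qed
  moreover have "finite (\<Union>J)" using JB finite_Union_blocks by (meson Union_mono finite_subset)
  moreover have "Min b \<le> Max b" using fin ne by simp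
  ultimately obtain I where "I \<in> runs (\<Union>J)" "{Min b..Max b} \<subseteq> I"
    using interval_subset_run by blast
  then show ?thesis using fin by (meson Max_ge Min_le atLeastAtMost_iff subset_iff)
qed

section \<open>Counting maps on monomials\<close>

definition map_count :: "(nat \<Rightarrow> nat \<Rightarrow> bool) \<Rightarrow> ncp_monomial \<Rightarrow> nat \<Rightarrow> nat" where
  "map_count R P n = card (order_maps R Bl_le (Bl P) n)"

lemma Bl_empty [simp]: "Bl {#} = {}"
  by (simp add: Bl_def)

lemma Bl_add_mset: "Bl (add_mset \<pi> P) = (\<lambda>b. (\<pi>, count P \<pi>, b)) ` blocks \<pi> \<union> Bl P"
  by (auto simp: Bl_def less_Suc_eq split: if_splits)

lemma finite_Bl: "finite (Bl P)"
  by (induction P) (simp_all add: Bl_add_mset)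

lemma Bl_eq_empty_iff: "Bl P = {} \<longleftrightarrow> P = {#}"
  by (cases P) (simp_all add: Bl_add_mset blocks_nonempty)

text \<open>The blocks of the new factor carry the index \<open>count P \<pi>\<close>, the first one not yet in use.\<close>

lemma map_count_add_mset:
  "map_count R (add_mset \<pi> P) n = card (order_maps R nest_le (blocks \<pi>) n) * map_count R P n"
proof -
  let ?N = "(\<lambda>b. (\<pi>, count P \<pi>, b)) ` blocks \<pi>"
  have "map_count R (add_mset \<pi> P) n = card (order_maps R Bl_le ?N n) * map_count R P n"
    unfolding map_count_def Bl_add_mset by (rule card_order_maps_Un) (auto simp: Bl_def)
  moreover have "card (order_maps R Bl_le ?N n) = card (order_maps R nest_le (blocks \<pi>) n)"
    by (rule card_order_maps_iso[of "\<lambda>b. (\<pi>, count P \<pi>, b)"])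
       (auto simp: bij_betw_def inj_on_def)
  ultimately show ?thesis by simp
qed

lemma map_count_empty: "map_count R {#} n = 1"
  by (simp add: map_count_def)

lemma map_count_single: "map_count R {#\<pi>#} n = card (order_maps R nest_le (blocks \<pi>) n)"
  by (simp add: map_count_add_mset map_count_empty)

lemma map_count_add: "map_count R (P + Q) n = map_count R P n * map_count R Q n"
  by (induction P) (simp_all add: map_count_add_mset map_count_empty)

lemma map_count_sum: "map_count R (\<Sum>i\<in>I. P i) n = (\<Prod>i\<in>I. map_count R (P i) n)"
  by (induction I rule: infinite_finite_induct) (simp_all add: map_count_add map_count_empty)

lemma map_count_0: "map_count R P 0 = (if P = {#} then 1 else 0)"
  by (simp add: map_count_empty) (simp add: map_count_def order_maps_0 Bl_eq_empty_iff)

lemma map_count_restrict_ncp: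
  assumes Y: "Y \<subseteq> blocks \<pi>"
  shows "map_count R (restrict_ncp Y) n = card (order_maps R nest_le Y n)"
proof (cases "Y = {}")
  case True
  then show ?thesis by (simp add: restrict_ncp_def map_count_empty)
next
  case False
  have fin: "finite (\<Union>Y)" using Y finite_Union_blocks by (meson Union_mono finite_subset)
  have "card (order_maps R nest_le (renumber Y) n) = card (order_maps R nest_le Y n)"
  proof (rule card_order_maps_iso[OF bij_betw_renumber[OF Y]])
    show "nest_le (rank_in (\<Union>Y) ` a) (rank_in (\<Union>Y) ` b) \<longleftrightarrow> nest_le a b"
      if "a \<in> Y" "b \<in> Y" for a b
      using that Y block_nonempty by (intro nest_le_rank_in_iff fin) blast+
  qed
  then show ?thesis
    using False by (simp add: restrict_ncp_def map_count_single blocks_Abs_renumber[OF Y])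
qed

text \<open>Splitting an ideal along its runs leaves the number of maps unchanged: each block
  of \<open>J\<close> lies in one run, and blocks in different runs are incomparable since the interval spanned
  by a block stays within its run.\<close>

lemma map_count_restrict_dot:
  assumes J: "J \<in> ideals \<pi>"
  shows "map_count R (restrict_dot \<pi> J) n = card (order_maps R nest_le J n)"
proof -
  let ?A = "\<lambda>I. {b \<in> blocks \<pi>. b \<subseteq> I}"
  have JB: "J \<subseteq> blocks \<pi>" using J by (auto simp: ideals_def)
  have fin: "finite (\<Union>J)" using JB finite_Union_blocks by (meson Union_mono finite_subset)
  have run_sub: "I \<subseteq> \<Union>J" if "I \<in> runs (\<Union>J)" for I
    using that by (simp add: runs_def)
  have "J = (\<Union>I\<in>runs (\<Union>J). ?A I)"
  proof (intro equalityI subsetI)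
    fix b assume "b \<in> J"
    then show "b \<in> (\<Union>I\<in>runs (\<Union>J). ?A I)" using block_of_ideal_subset_run[OF J] JB by blast
  next
    fix b assume "b \<in> (\<Union>I\<in>runs (\<Union>J). ?A I)"
    then obtain I where I: "I \<in> runs (\<Union>J)" "b \<in> blocks \<pi>" "b \<subseteq> I" by blast
    obtain x where x: "x \<in> b" using block_nonempty[OF I(2)] by blast
    then obtain b' where "b' \<in> J" "x \<in> b'" using I run_sub by blast
    then show "b \<in> J" using blocks_disjoint[OF I(2) _ x] JB by blast
  qed
  moreover have "card (order_maps R nest_le (\<Union>I\<in>runs (\<Union>J). ?A I) n)
      = (\<Prod>I\<in>runs (\<Union>J). card (order_maps R nest_le (?A I) n))"
  proof (rule card_order_maps_UN[OF finite_runs[OF fin]])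
    fix I I' assume I: "I \<in> runs (\<Union>J)" "I' \<in> runs (\<Union>J)" "I \<noteq> I'"
    have disj: "I \<inter> I' = {}" using run_disjoint I by blast
    then show "?A I \<inter> ?A I' = {}" using block_nonempty by blast
    show "\<not> nest_le b b'" if "b \<in> ?A I" "b' \<in> ?A I'" for b b'
    proof
      assume nest: "nest_le b b'"
      obtain u v where I_eq: "I = {u..v}" using I(1) unfolding runs_def by blast
      have "Min b \<in> I" "Max b \<in> I"
        using that finite_block[of b \<pi>] block_nonempty[of b \<pi>] Min_in[of b] Max_in[of b] by blast+
      then have "b' \<subseteq> I" using nest unfolding nest_le_def I_eq by (auto simp: subset_iff)
      then show False using that disj block_nonempty by blast
    qed
  qed
  moreover have "map_count R (restrict_dot \<pi> J) n
      = (\<Prod>I\<in>runs (\<Union>J). card (order_maps R nest_le (?A I) n))"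
    unfolding restrict_dot_def map_count_sum
    by (intro prod.cong refl map_count_restrict_ncp) blast
  ultimately show ?thesis by simp
qed

context comparison
begin

text \<open>The value at \<open>(m, n)\<close> of the compatibility with coproducts, for a single noncrossing
  partition.\<close>

lemma map_count_single_add:
  "map_count R {#\<pi>#} (m + n) =
     (\<Sum>J\<in>ideals \<pi>. map_count R (restrict_ncp (blocks \<pi> - J)) m * map_count R (restrict_dot \<pi> J) n)"
proof -
  have "map_count R {#\<pi>#} (m + n) = (\<Sum>J\<in>ideals \<pi>.
      card (order_maps R nest_le (blocks \<pi> - J) m) * card (order_maps R nest_le J n))"
    by (simp only: map_count_single card_order_maps_add[OF finite_blocks] ideals_eq_up_sets)
  also have "\<dots> = (\<Sum>J\<in>ideals \<pi>.
      map_count R (restrict_ncp (blocks \<pi> - J)) m * map_count R (restrict_dot \<pi> J) n)"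
    by (rule sum.cong[OF refl])
       (simp only: map_count_restrict_dot map_count_restrict_ncp[OF Diff_subset])
  finally show ?thesis .
qed

end

section \<open>Left convolution inverses\<close>

text \<open>The term of the empty ideal is \<open>\<pi> \<otimes> 1\<close>, and any other ideal removes blocks from the left
  factor.\<close>

lemma coprod_gen_leading_term:
  "\<exists>R :: ncp_monomial \<times> ncp_monomial \<Rightarrow>\<^sub>0 'k::field. coprod_gen \<pi> = basis_elt ({#\<pi>#}, {#}) + R \<and>
     (\<forall>(P, Q)\<in>Poly_Mapping.keys R. block_count P < card (blocks \<pi>))"
proof -
  let ?t = "\<lambda>J. basis_elt (restrict_ncp (blocks \<pi> - J), restrict_dot \<pi> J)
    :: ncp_monomial \<times> ncp_monomial \<Rightarrow>\<^sub>0 'k"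
  let ?R = "\<Sum>J\<in>ideals \<pi> - {{}}. ?t J"
  have "coprod_gen \<pi> = ?t {} + ?R"
    unfolding coprod_gen_def ideals_eq_up_sets
    by (rule sum.remove) (auto simp: finite_up_sets up_sets_def)
  then have "coprod_gen \<pi> = basis_elt ({#\<pi>#}, {#}) + ?R"
    by (simp add: restrict_ncp_blocks restrict_dot_empty)
  moreover have "block_count P < card (blocks \<pi>)" if PQ: "(P, Q) \<in> Poly_Mapping.keys ?R" for P Q
  proof -
    obtain J where J: "J \<in> ideals \<pi>" "J \<noteq> {}" "P = restrict_ncp (blocks \<pi> - J)"
      using keys_sum[of ?t "ideals \<pi> - {{}}"] PQ by (fastforce simp: basis_elt_def)
    have "blocks \<pi> - J \<subset> blocks \<pi>" using J(1,2) by (auto simp: ideals_def)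
    then show ?thesis
      unfolding J(3) block_count_restrict_ncp[OF Diff_subset] by (simp add: psubset_card_mono)
  qed
  ultimately show ?thesis by blast
qed

lemma coprod_leading_term:
  "\<exists>R :: ncp_monomial \<times> ncp_monomial \<Rightarrow>\<^sub>0 'k::field.
     (\<Prod>\<pi>\<in>#P. coprod_gen \<pi>) = basis_elt (P, {#}) + R \<and>
     (\<forall>(P', Q)\<in>Poly_Mapping.keys R. block_count P' < block_count P)"
proof (induction P)
  case empty
  have "basis_elt ({#}, {#}) = (1 :: ncp_monomial \<times> ncp_monomial \<Rightarrow>\<^sub>0 'k)"
    using basis_elt_0[where 'a = "ncp_monomial \<times> ncp_monomial"] by (simp add: zero_prod_def)
  then show ?case by (intro exI[of _ 0]) simp
next
  case (add \<pi> P)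
  obtain R :: "ncp_monomial \<times> ncp_monomial \<Rightarrow>\<^sub>0 'k"
    where R: "(\<Prod>\<pi>\<in>#P. coprod_gen \<pi>) = basis_elt (P, {#}) + R"
      and keys_R: "\<And>P' Q. (P', Q) \<in> Poly_Mapping.keys R \<Longrightarrow> block_count P' < block_count P"
    using add.IH by blast
  obtain S :: "ncp_monomial \<times> ncp_monomial \<Rightarrow>\<^sub>0 'k"
    where S: "coprod_gen \<pi> = basis_elt ({#\<pi>#}, {#}) + S"
      and keys_S: "\<And>P' Q. (P', Q) \<in> Poly_Mapping.keys S \<Longrightarrow> block_count P' < card (blocks \<pi>)"
    using coprod_gen_leading_term by blast
  let ?e = "basis_elt :: _ \<Rightarrow> ncp_monomial \<times> ncp_monomial \<Rightarrow>\<^sub>0 'k"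
  let ?T = "?e ({#\<pi>#}, {#}) * R + S * (?e (P, {#}) + R)"
  have "?e ({#\<pi>#}, {#}) * ?e (P, {#}) = ?e (add_mset \<pi> P, {#})"
    by (simp add: basis_elt_mult)
  then have "(\<Prod>\<pi>\<in>#add_mset \<pi> P. coprod_gen \<pi>) = ?e (add_mset \<pi> P, {#}) + ?T"
    by (simp add: R S algebra_simps)
  moreover have "block_count P' < block_count (add_mset \<pi> P)"
    if PQ: "(P', Q) \<in> Poly_Mapping.keys ?T" for P' Q
  proof -
    have add: "block_count (A + B) = block_count A + block_count B" for A B
      by (simp add: block_count_def)
    have pi: "block_count {#\<pi>#} = card (blocks \<pi>)" by (simp add: block_count_def)
    consider "(P', Q) \<in> Poly_Mapping.keys (?e ({#\<pi>#}, {#}) * R)"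
      | "(P', Q) \<in> Poly_Mapping.keys (S * (?e (P, {#}) + R))"
      using PQ keys_add[of "?e ({#\<pi>#}, {#}) * R" "S * (?e (P, {#}) + R)"] by blast
    then have "block_count P' < card (blocks \<pi>) + block_count P"
    proof cases
      case 1
      then obtain A B where "(A, B) \<in> Poly_Mapping.keys R" "P' = {#\<pi>#} + A"
        using keys_mult[of "?e ({#\<pi>#}, {#})" R] by (fastforce simp: basis_elt_def)
      then show ?thesis using keys_R by (simp only: add pi) simp
    next
      case 2
      then obtain A B A' B' where A: "(A, B) \<in> Poly_Mapping.keys S"
        and A': "(A', B') \<in> Poly_Mapping.keys (?e (P, {#}) + R)" and P': "P' = A + A'"
        using keys_mult[of S "?e (P, {#}) + R"] by fastforce
      have "A' = P \<or> block_count A' < block_count P"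
        using A' keys_add[of "?e (P, {#})" R] keys_R by (fastforce simp: basis_elt_def)
      then show ?thesis using keys_S[OF A] P' by (auto simp: add)
    qed
    then show ?thesis by (simp add: block_count_def)
  qed
  ultimately show ?case by blast
qed

text \<open>Since the coproduct of \<open>P\<close> is \<open>P \<otimes> 1\<close> plus terms with fewer blocks on the left, the convolution
  of \<open>G\<close> and \<open>F\<close> at \<open>P\<close> is \<open>G(P)\<close> plus values of \<open>G\<close> at smaller monomials. It therefore
  determines \<open>G\<close> recursively.\<close>

lemma left_convolution_inverse_unique:
  fixes G G' F :: "ncp_monomial \<Rightarrow> 'k::field poly"
  assumes F: "F {#} = 1"
    and conv: "\<And>P. lin_ext smult (\<lambda>(P, Q). G P * F Q) (\<Prod>\<pi>\<in>#P. coprod_gen \<pi>) =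
      lin_ext smult (\<lambda>(P, Q). G' P * F Q) (\<Prod>\<pi>\<in>#P. coprod_gen \<pi>)"
  shows "G P = G' P"
proof (induction P rule: measure_induct_rule[of block_count])
  case (less P)
  obtain R :: "ncp_monomial \<times> ncp_monomial \<Rightarrow>\<^sub>0 'k"
    where R: "(\<Prod>\<pi>\<in>#P. coprod_gen \<pi>) = basis_elt (P, {#}) + R"
      and keys_R: "\<And>P' Q. (P', Q) \<in> Poly_Mapping.keys R \<Longrightarrow> block_count P' < block_count P"
    using coprod_leading_term by blast
  have expand: "lin_ext smult (\<lambda>(P, Q). H P * F Q) (\<Prod>\<pi>\<in>#P. coprod_gen \<pi>) =
      H P + lin_ext smult (\<lambda>(P, Q). H P * F Q) R" for H
    unfolding R linear_apply_add[OF linear_lin_ext[OF vector_space_smult]]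
      lin_ext_basis_elt[OF vector_space_smult] by (simp add: F)
  have "lin_ext smult (\<lambda>(P, Q). G P * F Q) R = lin_ext smult (\<lambda>(P, Q). G' P * F Q) R"
    unfolding lin_ext_def using less.IH keys_R by (intro sum.cong refl) fastforce
  then show ?case using conv[of P] unfolding expand by simp
qed

lemma coprod_ncp_basis_elt: "coprod_ncp (basis_elt P) = (\<Prod>\<pi>\<in>#P. coprod_gen \<pi>)"
  unfolding coprod_ncp_def by (rule lin_ext_basis_elt[OF vector_space_pm_scale])

section \<open>Hopf algebra morphisms from counting polynomials\<close>

text \<open>After evaluation at \<open>(m, n)\<close> both sides of the coproduct identity are multiplicative in the
  monomial, so the hypothesis on single noncrossing partitions suffices. For antipodes \<open>S\<close> and
  \<open>S'\<close>, both \<open>F \<circ> S\<close> and \<open>S' \<circ> F\<close> are left convolution inverses of \<open>F\<close>, the first because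
  \<open>F\<close> is an algebra morphism and the second because \<open>F\<close> is a coalgebra morphism.\<close>

lemma hopf_morphismI:
  fixes L :: "ncp_monomial \<Rightarrow> 'k::field_char_0 poly" and c :: "ncp_monomial \<Rightarrow> nat \<Rightarrow> nat"
  assumes L: "\<And>P n. poly (L P) (of_nat n) = of_nat (c P n)"
    and c_0: "\<And>P. c P 0 = (if P = {#} then 1 else 0)"
    and c_one: "\<And>n. c {#} n = 1"
    and c_mult: "\<And>P Q n. c (P + Q) n = c P n * c Q n"
    and c_add: "\<And>\<pi> m n. c {#\<pi>#} (m + n) =
      (\<Sum>J\<in>ideals \<pi>. c (restrict_ncp (blocks \<pi> - J)) m * c (restrict_dot \<pi> J) n)"
  shows "hopf_morphism (lin_ext smult L)"
proof -
  let ?F = "lin_ext smult L"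
  have L_one: "L {#} = 1"
    by (rule poly_eq_if_eq_on_nats) (simp add: L c_one)
  have L_mult: "L (P + Q) = L P * L Q" for P Q
    by (rule poly_eq_if_eq_on_nats) (simp add: L c_mult)
  have lin_F: "Vector_Spaces.linear pm_scale smult ?F"
    by (rule linear_lin_ext[OF vector_space_smult])
  have F_basis: "?F (basis_elt P) = L P" for P
    by (rule lin_ext_basis_elt[OF vector_space_smult])
  have F_one: "?F 1 = 1"
    using lin_ext_one[OF vector_space_smult, of L] L_one by simp
  have F_mult: "?F (x * y) = ?F x * ?F y" for x y
    by (rule lin_ext_mult[OF vector_space_smult]) (simp_all add: L_mult)

  have coprod: "coprod_poly (?F x) = tensor_map ?F (coprod_ncp x)" for x
  proof (rule eval2_eqD)
    fix m n
    let ?g = "\<lambda>(P, Q). of_nat (c P m) * of_nat (c Q n) :: 'k"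
    let ?ev = "eval2 (of_nat m) (of_nat n) :: _ \<Rightarrow> 'k"
    have ev_tensor: "?ev (tensor_map ?F z) = lin_ext (*) ?g z" for z
      unfolding tensor_map_def linear_apply_lin_ext[OF vector_space_pm_scale linear_eval2]
      by (simp add: case_prod_unfold eval2_tensor_poly F_basis L)
    have lin_left: "Vector_Spaces.linear pm_scale (*) (\<lambda>x. poly (?F x) (of_nat (m + n)))"
      by (rule linear_comp[OF lin_F linear_poly_eval])
    have lin_right: "Vector_Spaces.linear pm_scale (*) (\<lambda>x. lin_ext (*) ?g (coprod_ncp x))"
      unfolding coprod_ncp_def
      by (rule linear_comp[OF linear_lin_ext[OF vector_space_pm_scale]
            linear_lin_ext[OF vector_space_mult]])
    have gen: "lin_ext (*) ?g (coprod_gen \<pi>) = of_nat (c {#\<pi>#} (m + n))" for \<pi>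
      unfolding coprod_gen_def linear_sum_apply[OF linear_lin_ext[OF vector_space_mult]]
        lin_ext_basis_elt[OF vector_space_mult] c_add by simp
    have c_prod: "(\<Prod>\<pi>\<in>#P. of_nat (c {#\<pi>#} k)) = (of_nat (c P k) :: 'k)" for P k
    proof (induction P)
      case (add \<pi> P)
      then show ?case using c_mult[of "{#\<pi>#}" P k] by simp
    qed (simp add: c_one)
    have "lin_ext (*) ?g (\<Prod>\<pi>\<in>#P. coprod_gen \<pi>) = of_nat (c P (m + n))" for P
    proof -
      have "lin_ext (*) ?g (\<Prod>\<pi>\<in>#P. coprod_gen \<pi>) = (\<Prod>\<pi>\<in>#P. lin_ext (*) ?g (coprod_gen \<pi>))"
        by (rule lin_ext_prod_mset[OF vector_space_mult])
           (auto simp: zero_prod_def c_one c_mult algebra_simps)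
      then show ?thesis by (simp add: gen c_prod)
    qed
    then have "poly (?F x) (of_nat (m + n)) = lin_ext (*) ?g (coprod_ncp x)"
      using linear_eq_on_basis[OF lin_left lin_right]
      by (simp add: F_basis coprod_ncp_basis_elt L del: of_nat_add)
    then show "?ev (coprod_poly (?F x)) = ?ev (tensor_map ?F (coprod_ncp x))"
      by (simp add: eval2_coprod_poly ev_tensor)
  qed

  have counit: "counit_poly (?F x) = counit_ncp x" for x
  proof -
    have "poly (L P) 0 = (\<Prod>\<pi>\<in>#P. 0)" for P
      using L[of P 0] c_0[of P] by (cases P) simp_all
    then show ?thesis
      unfolding counit_poly_def counit_ncp_def
        linear_apply_lin_ext[OF vector_space_smult linear_poly_eval] by simp
  qed

  have antipode: "?F \<circ> S = S' \<circ> ?F" if S: "is_antipode_ncp S" and S': "is_antipode_poly S'" for S S'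
  proof
    fix x
    have lin_S: "Vector_Spaces.linear pm_scale pm_scale S"
      and lin_S': "Vector_Spaces.linear smult smult S'"
      using S S' unfolding is_antipode_def by blast+
    have inv_S: "lin_ext smult (\<lambda>(P, Q). ?F (S (basis_elt P)) * L Q) (coprod_ncp z)
        = smult (counit_ncp z) 1" for z
    proof -
      have "?F (lin_ext pm_scale (\<lambda>(P, Q). S (basis_elt P) * basis_elt Q) (coprod_ncp z))
          = lin_ext smult (\<lambda>(P, Q). ?F (S (basis_elt P)) * L Q) (coprod_ncp z)"
        unfolding linear_apply_lin_ext[OF vector_space_pm_scale lin_F]
        by (simp add: case_prod_unfold F_mult F_basis)
      moreover have "lin_ext pm_scale (\<lambda>(P, Q). S (basis_elt P) * basis_elt Q) (coprod_ncp z)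
          = pm_scale (counit_ncp z) 1"
        using S unfolding is_antipode_def by blast
      ultimately show ?thesis by (simp add: linear_apply_scale[OF lin_F] F_one)
    qed
    have inv_S': "lin_ext smult (\<lambda>(P, Q). S' (L P) * L Q) (coprod_ncp z)
        = smult (counit_ncp z) 1" for z
    proof -
      let ?h = "\<lambda>(i, j). S' (monom 1 i) * monom 1 j"
      have "lin_ext smult ?h (tensor_map ?F (coprod_ncp z))
          = lin_ext smult (\<lambda>(P, Q). S' (L P) * L Q) (coprod_ncp z)"
        unfolding tensor_map_def
          linear_apply_lin_ext[OF vector_space_pm_scale linear_lin_ext[OF vector_space_smult]]
        by (simp add: case_prod_unfold F_basis lin_ext_tensor_poly[OF lin_S', unfolded case_prod_unfold])
      moreover have "lin_ext smult ?h (coprod_poly (?F z)) = smult (counit_poly (?F z)) 1"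
        using S' unfolding is_antipode_def by blast
      ultimately show ?thesis by (simp add: coprod counit)
    qed
    have "?F (S (basis_elt P)) = S' (L P)" for P
    proof (rule left_convolution_inverse_unique[where F = L and G = "\<lambda>P. ?F (S (basis_elt P))"
          and G' = "\<lambda>P. S' (L P)", OF L_one])
      fix P
      show "lin_ext smult (\<lambda>(P, Q). ?F (S (basis_elt P)) * L Q) (\<Prod>\<pi>\<in>#P. coprod_gen \<pi>)
          = lin_ext smult (\<lambda>(P, Q). S' (L P) * L Q) (\<Prod>\<pi>\<in>#P. coprod_gen \<pi>)"
        using inv_S[of "basis_elt P"] inv_S'[of "basis_elt P"]
        unfolding coprod_ncp_basis_elt by (rule trans[OF _ sym])
    qed
    then have "?F (S x) = S' (?F x)"
      using linear_eq_on_basis[OF linear_comp[OF lin_S lin_F] linear_comp[OF lin_F lin_S']]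
      by (simp add: F_basis)
    then show "(?F \<circ> S) x = (S' \<circ> ?F) x" by simp
  qed

  show ?thesis
    unfolding hopf_morphism_def using lin_F F_one F_mult coprod counit antipode by blast
qed

lemma Lin_eq_order_maps: "Lin P n = order_maps (\<le>) Bl_le (Bl P) n"
  unfolding Lin_def order_maps_def by (intro Collect_cong) force

lemma Lin_s_eq_order_maps: "Lin_s P n = order_maps (<) Bl_le (Bl P) n"
  unfolding Lin_s_def order_maps_def by simp

context comparison
begin

lemma ex1_map_count_polynomial:
  "\<exists>!p :: 'k::field_char_0 poly. \<forall>n\<ge>1. poly p (of_nat n) = of_nat (map_count R P n)"
proof -
  obtain p :: "'k poly" where "\<forall>n. poly p (of_nat n) = of_nat (map_count R P n)"
    using card_order_maps_polynomial[OF finite_Bl] unfolding map_count_def by blast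
  then show ?thesis by (intro ex1I[of _ p]) (auto intro: poly_eq_if_eq_on_nats)
qed

lemma hopf_morphism_map_count:
  fixes L :: "ncp_monomial \<Rightarrow> 'k::field_char_0 poly"
  assumes L: "\<And>P. L P = (THE p. \<forall>n\<ge>1. poly p (of_nat n) = of_nat (map_count R P n))"
  shows "hopf_morphism (lin_ext smult L)"
proof (rule hopf_morphismI)
  show "poly (L P) (of_nat n) = of_nat (map_count R P n)" for P n
  proof -
    obtain p :: "'k poly" where p: "\<forall>n. poly p (of_nat n) = of_nat (map_count R P n)"
      using card_order_maps_polynomial[OF finite_Bl] unfolding map_count_def by blast
    have "L P = p"
      unfolding L using p by (intro the1_equality ex1_map_count_polynomial) blast
    then show ?thesis using p by blast
  qed
qed (fact map_count_0 map_count_empty map_count_add map_count_single_add)+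

end

theorem theorem4p11:
  shows
    "((\<forall>P. \<exists>!p::'k::field_char_0 poly.
         \<forall>n\<ge>1. poly p (of_nat n) = of_nat (card (Lin P n))) \<and>
      hopf_morphism (lin_ext smult (Lambda :: ncp_monomial \<Rightarrow> 'k poly))) \<and>
     ((\<forall>P. \<exists>!p::'k poly.
         \<forall>n\<ge>1. poly p (of_nat n) = of_nat (card (Lin_s P n))) \<and>
      hopf_morphism (lin_ext smult (Lambda_s :: ncp_monomial \<Rightarrow> 'k poly)))"
proof -
  interpret weak: comparison "(\<le>)" by unfold_locales auto
  interpret strict: comparison "(<)" by unfold_locales auto
  show ?thesis
  proof (intro conjI allI)
    show "\<exists>!p::'k poly. \<forall>n\<ge>1. poly p (of_nat n) = of_nat (card (Lin P n))" for P
      using weak.ex1_map_count_polynomial unfolding map_count_def Lin_eq_order_maps .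
    show "hopf_morphism (lin_ext smult (Lambda :: ncp_monomial \<Rightarrow> 'k poly))"
      by (rule weak.hopf_morphism_map_count)
        (simp only: Lambda_def map_count_def Lin_eq_order_maps)
    show "\<exists>!p::'k poly. \<forall>n\<ge>1. poly p (of_nat n) = of_nat (card (Lin_s P n))" for P
      using strict.ex1_map_count_polynomial unfolding map_count_def Lin_s_eq_order_maps .
    show "hopf_morphism (lin_ext smult (Lambda_s :: ncp_monomial \<Rightarrow> 'k poly))"
      by (rule strict.hopf_morphism_map_count)
        (simp only: Lambda_s_def map_count_def Lin_s_eq_order_maps)
  qed
qed

end
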